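(* No model of $\mathrm{ZF}$ is parametrically bi-interpretable with a model of $\mathrm{ZFI}$.
   Context: $\mathrm{ZFI}$ is the theory in $\{=,\in,I\}$ ($I$ unary): ZF with separation and collection for all formulae of this language; "$I$ is a cofinal subclass of $\mathrm{Ord}$"; and for each $\{=,\in\}$-formula $\varphi(v_1,\dots,v_n)$, for all $x_1\in\cdots\in x_n$, $y_1\in\cdots\in y_n$ in $I$, $\varphi(\bar x)\leftrightarrow\varphi(\bar y)$. A structure $\mathcal{N}$ is parametrically interpretable in $\mathcal{M}$ ($\mathcal{N}\trianglelefteq_{\mathrm{par}}\mathcal{M}$) if $\mathcal{N}$ is isomorphic to a structure whose universe and interpretations of all symbols are definable in $\mathcal{M}$ with parameters; such a parametric interpretation $\mathcal{I}$ produces $\mathcal{M}^{\mathcal{I}}$. $\mathcal{M}$ and $\mathcal{N}$ are parametrically bi-interpretable if there are parametric interpretations $\mathcal{I}$ (of $\mathcal{M}$ in $\mathcal{N}$, giving $\mathcal{N}^{\mathcal{I}}\cong\mathcal{M}$) and $\mathcal{J}$ (of $\mathcal{N}$ in $\mathcal{M}$, giving $\mathcal{M}^{\mathcal{J}}\cong\mathcal{N}$), together with a parametrically $\mathcal{M}$-definable isomorphism $F:\mathcal{M}\to(\mathcal{M}^{\mathcal{J}})^{\mathcal{I}}$ and a parametrically $\mathcal{N}$-definable isomorphism $G:\mathcal{N}\to(\mathcal{N}^{\mathcal{I}})^{\mathcal{J}}$. *)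

theory Defs
  imports Main
begin

class rel_sym =
  fixes arity :: "'a \<Rightarrow> nat"

text \<open>
  First-order formulas with identity over the relation symbols in \<^typ>\<open>'r\<close>, with de Bruijn
  variables: \<open>All\<close> and \<open>Ex\<close> bind variable 0 and shift the other variables by one.
\<close>

datatype 'r fm =
    Eq nat nat
  | Rel 'r "nat list"
  | Neg "'r fm"
  | And "'r fm" "'r fm"
  | All "'r fm"

definition Or :: "'r fm \<Rightarrow> 'r fm \<Rightarrow> 'r fm" where
  "Or \<phi> \<psi> = Neg (And (Neg \<phi>) (Neg \<psi>))"

definition Imp :: "'r fm \<Rightarrow> 'r fm \<Rightarrow> 'r fm" where
  "Imp \<phi> \<psi> = Neg (And \<phi> (Neg \<psi>))"

definition Iff :: "'r fm \<Rightarrow> 'r fm \<Rightarrow> 'r fm" where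
  "Iff \<phi> \<psi> = And (Imp \<phi> \<psi>) (Imp \<psi> \<phi>)"

definition Ex :: "'r fm \<Rightarrow> 'r fm" where
  "Ex \<phi> = Neg (All (Neg \<phi>))"

primrec wf_fm :: "'r::rel_sym fm \<Rightarrow> bool" where
  "wf_fm (Eq i j) \<longleftrightarrow> True"
| "wf_fm (Rel r is) \<longleftrightarrow> length is = arity r"
| "wf_fm (Neg \<phi>) \<longleftrightarrow> wf_fm \<phi>"
| "wf_fm (And \<phi> \<psi>) \<longleftrightarrow> wf_fm \<phi> \<and> wf_fm \<psi>"
| "wf_fm (All \<phi>) \<longleftrightarrow> wf_fm \<phi>"

primrec fv :: "'r fm \<Rightarrow> nat set" where
  "fv (Eq i j) = {i, j}"
| "fv (Rel r is) = set is"
| "fv (Neg \<phi>) = fv \<phi>"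
| "fv (And \<phi> \<psi>) = fv \<phi> \<union> fv \<psi>"
| "fv (All \<phi>) = {i. Suc i \<in> fv \<phi>}"

primrec ren :: "(nat \<Rightarrow> nat) \<Rightarrow> 'r fm \<Rightarrow> 'r fm" where
  "ren f (Eq i j) = Eq (f i) (f j)"
| "ren f (Rel r is) = Rel r (map f is)"
| "ren f (Neg \<phi>) = Neg (ren f \<phi>)"
| "ren f (And \<phi> \<psi>) = And (ren f \<phi>) (ren f \<psi>)"
| "ren f (All \<phi>) = All (ren (case_nat 0 (\<lambda>i. Suc (f i))) \<phi>)"

text \<open>
  Only the values of \<open>rel M r\<close> on lists of length \<open>arity r\<close> over \<open>univ M\<close> are meaningful.
\<close>

record ('r, 'a) fo_struct =
  univ :: "'a set"
  rel :: "'r \<Rightarrow> 'a list \<Rightarrow> bool"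

primrec sat :: "('r, 'a) fo_struct \<Rightarrow> (nat \<Rightarrow> 'a) \<Rightarrow> 'r fm \<Rightarrow> bool" where
  "sat M e (Eq i j) \<longleftrightarrow> e i = e j"
| "sat M e (Rel r is) \<longleftrightarrow> rel M r (map e is)"
| "sat M e (Neg \<phi>) \<longleftrightarrow> \<not> sat M e \<phi>"
| "sat M e (And \<phi> \<psi>) \<longleftrightarrow> sat M e \<phi> \<and> sat M e \<psi>"
| "sat M e (All \<phi>) \<longleftrightarrow> (\<forall>a \<in> univ M. sat M (case_nat a e) \<phi>)"

text \<open>Free variables of axioms are read as universally quantified.\<close>

definition models :: "('r, 'a) fo_struct \<Rightarrow> 'r fm set \<Rightarrow> bool" (infix "\<Turnstile>" 50) where
  "M \<Turnstile> T \<longleftrightarrow>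
     univ M \<noteq> {} \<and> (\<forall>\<phi> \<in> T. \<forall>e. range e \<subseteq> univ M \<longrightarrow> sat M e \<phi>)"

lemma sat_connectives [simp]:
  "sat M e (Iff \<phi> \<psi>) \<longleftrightarrow> (sat M e \<phi> \<longleftrightarrow> sat M e \<psi>)"
  "sat M e (Imp \<phi> \<psi>) \<longleftrightarrow> (sat M e \<phi> \<longrightarrow> sat M e \<psi>)"
  "sat M e (Or \<phi> \<psi>) \<longleftrightarrow> sat M e \<phi> \<or> sat M e \<psi>"
  "sat M e (Ex \<phi>) \<longleftrightarrow> (\<exists>a \<in> univ M. sat M (case_nat a e) \<phi>)"
  by (auto simp: Or_def Imp_def Iff_def Ex_def)

lemma sat_ren: "sat M e (ren f \<phi>) \<longleftrightarrow> sat M (e \<circ> f) \<phi>"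
proof (induction \<phi> arbitrary: e f)
  case (All \<phi>)
  have "case_nat a e \<circ> case_nat 0 (\<lambda>i. Suc (f i)) = case_nat a (e \<circ> f)" for a
    by (rule ext) (simp split: nat.split)
  then show ?case by (simp add: All.IH comp_def)
qed auto

section \<open>ZF and ZFI\<close>

text \<open>
  The axioms of ZF in a language with membership symbol \<open>E\<close>; separation and collection range
  over all formulas of that language.
\<close>

definition ax_ext :: "'r \<Rightarrow> 'r fm" where
  "ax_ext E = All (All (Imp (All (Iff (Rel E [0, 2]) (Rel E [0, 1]))) (Eq 1 0)))"

definition ax_found :: "'r \<Rightarrow> 'r fm" where
  "ax_found E = All (Imp (Ex (Rel E [0, 1]))
     (Ex (And (Rel E [0, 1]) (Neg (Ex (And (Rel E [0, 2]) (Rel E [0, 1])))))))"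

definition ax_pair :: "'r \<Rightarrow> 'r fm" where
  "ax_pair E = All (All (Ex (And (Rel E [2, 0]) (Rel E [1, 0]))))"

definition ax_union :: "'r \<Rightarrow> 'r fm" where
  "ax_union E = All (Ex (All (All (Imp (And (Rel E [0, 1]) (Rel E [1, 3])) (Rel E [0, 2])))))"

definition ax_power :: "'r \<Rightarrow> 'r fm" where
  "ax_power E = All (Ex (All (Imp (All (Imp (Rel E [0, 1]) (Rel E [0, 3]))) (Rel E [0, 1]))))"

definition ax_inf :: "'r \<Rightarrow> 'r fm" where
  "ax_inf E = Ex (And
     (Ex (And (Rel E [0, 1]) (All (Neg (Rel E [0, 1])))))
     (All (Imp (Rel E [0, 1])
        (Ex (And (Rel E [0, 2]) (All (Iff (Rel E [0, 1]) (Or (Rel E [0, 2]) (Eq 0 2)))))))))"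

text \<open>
  In separation, variable 0 of \<open>\<phi>\<close> is the element and the others are parameters. In collection,
  variable 1 of \<open>\<phi>\<close> is the argument, variable 0 the value, and the others are parameters.
\<close>

definition ax_sep :: "'r \<Rightarrow> 'r fm \<Rightarrow> 'r fm" where
  "ax_sep E \<phi> = All (Ex (All (Iff (Rel E [0, 1])
     (And (Rel E [0, 2]) (ren (\<lambda>i. if i < 1 then i else i + 2) \<phi>)))))"

definition ax_coll :: "'r \<Rightarrow> 'r fm \<Rightarrow> 'r fm" where
  "ax_coll E \<phi> = All (Imp
     (All (Imp (Rel E [0, 1]) (Ex (ren (\<lambda>i. if i < 2 then i else i + 1) \<phi>))))
     (Ex (All (Imp (Rel E [0, 2])
        (Ex (And (Rel E [0, 2]) (ren (\<lambda>i. if i < 2 then i else i + 2) \<phi>)))))))"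

definition ZF_axioms :: "'r::rel_sym \<Rightarrow> 'r fm set" where
  "ZF_axioms E =
     {ax_ext E, ax_found E, ax_pair E, ax_union E, ax_power E, ax_inf E}
     \<union> {ax_sep E \<phi> |\<phi>. wf_fm \<phi>} \<union> {ax_coll E \<phi> |\<phi>. wf_fm \<phi>}"

lemma sat_ZF_axioms:
  fixes M :: "('r, 'a) fo_struct" and E :: 'r
  defines "U \<equiv> univ M"
  defines "mem \<equiv> \<lambda>x y. rel M E [x, y]"
  shows
    "sat M e (ax_ext E) \<longleftrightarrow>
       (\<forall>x\<in>U. \<forall>y\<in>U. (\<forall>z\<in>U. mem z x \<longleftrightarrow> mem z y) \<longrightarrow> x = y)"
    "sat M e (ax_found E) \<longleftrightarrow>
       (\<forall>x\<in>U. (\<exists>y\<in>U. mem y x) \<longrightarrow>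
          (\<exists>y\<in>U. mem y x \<and> \<not> (\<exists>z\<in>U. mem z x \<and> mem z y)))"
    "sat M e (ax_pair E) \<longleftrightarrow> (\<forall>x\<in>U. \<forall>y\<in>U. \<exists>z\<in>U. mem x z \<and> mem y z)"
    "sat M e (ax_union E) \<longleftrightarrow>
       (\<forall>x\<in>U. \<exists>u\<in>U. \<forall>y\<in>U. \<forall>z\<in>U. mem z y \<and> mem y x \<longrightarrow> mem z u)"
    "sat M e (ax_power E) \<longleftrightarrow>
       (\<forall>x\<in>U. \<exists>p\<in>U. \<forall>y\<in>U. (\<forall>z\<in>U. mem z y \<longrightarrow> mem z x) \<longrightarrow> mem y p)"
    "sat M e (ax_inf E) \<longleftrightarrow>
       (\<exists>x\<in>U. (\<exists>y\<in>U. mem y x \<and> (\<forall>z\<in>U. \<not> mem z y)) \<and>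
          (\<forall>y\<in>U. mem y x \<longrightarrow>
             (\<exists>w\<in>U. mem w x \<and> (\<forall>z\<in>U. mem z w \<longleftrightarrow> mem z y \<or> z = y))))"
    "sat M e (ax_sep E \<phi>) \<longleftrightarrow>
       (\<forall>a\<in>U. \<exists>b\<in>U. \<forall>x\<in>U. mem x b \<longleftrightarrow> mem x a \<and> sat M (case_nat x e) \<phi>)"
    "sat M e (ax_coll E \<phi>) \<longleftrightarrow>
       (\<forall>a\<in>U. (\<forall>x\<in>U. mem x a \<longrightarrow> (\<exists>y\<in>U. sat M (case_nat y (case_nat x e)) \<phi>)) \<longrightarrow>
          (\<exists>b\<in>U. \<forall>x\<in>U. mem x a \<longrightarrow>
             (\<exists>y\<in>U. mem y b \<and> sat M (case_nat y (case_nat x e)) \<phi>)))"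
proof -
  have sep: "case_nat x (case_nat b (case_nat a e)) \<circ> (\<lambda>i. if i < 1 then i else i + 2) = case_nat x e"
    for x b a :: 'a
    by (rule ext) (simp split: nat.split)
  have coll1: "case_nat y (case_nat x (case_nat a e)) \<circ> (\<lambda>i. if i < 2 then i else i + 1)
      = case_nat y (case_nat x e)" for y x a :: 'a
    by (rule ext) (simp add: numeral_2_eq_2 split: nat.split)
  have coll2: "case_nat y (case_nat x (case_nat b (case_nat a e))) \<circ> (\<lambda>i. if i < 2 then i else i + 2)
      = case_nat y (case_nat x e)" for y x b a :: 'a
    by (rule ext) (simp add: numeral_2_eq_2 split: nat.split)
  show "sat M e (ax_sep E \<phi>) \<longleftrightarrow>
       (\<forall>a\<in>U. \<exists>b\<in>U. \<forall>x\<in>U. mem x b \<longleftrightarrow> mem x a \<and> sat M (case_nat x e) \<phi>)"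
    unfolding ax_sep_def sat_connectives sat.simps sat_ren sep
    by (simp add: U_def mem_def numeral_2_eq_2)
  show "sat M e (ax_coll E \<phi>) \<longleftrightarrow>
       (\<forall>a\<in>U. (\<forall>x\<in>U. mem x a \<longrightarrow> (\<exists>y\<in>U. sat M (case_nat y (case_nat x e)) \<phi>)) \<longrightarrow>
          (\<exists>b\<in>U. \<forall>x\<in>U. mem x a \<longrightarrow>
             (\<exists>y\<in>U. mem y b \<and> sat M (case_nat y (case_nat x e)) \<phi>)))"
    unfolding ax_coll_def sat_connectives sat.simps sat_ren coll1 coll2 by (simp add: U_def mem_def numeral_eq_Suc)
qed (simp_all add: ax_ext_def ax_found_def ax_pair_def ax_union_def ax_power_def ax_inf_def
       U_def mem_def numeral_eq_Suc)

datatype set_sym = Mem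

datatype seti_sym = MemI | Ind

instantiation set_sym :: rel_sym
begin
definition arity_set_sym :: "set_sym \<Rightarrow> nat" where
  "arity_set_sym r = 2"
instance ..
end

instantiation seti_sym :: rel_sym
begin
definition arity_seti_sym :: "seti_sym \<Rightarrow> nat" where
  "arity_seti_sym r = (case r of MemI \<Rightarrow> 2 | Ind \<Rightarrow> 1)"
instance ..
end

definition ZF :: "set_sym fm set" where
  "ZF = ZF_axioms Mem"

text \<open>An ordinal is a transitive set of transitive sets (in the presence of foundation).\<close>

definition fm_trans :: "nat \<Rightarrow> seti_sym fm" where
  "fm_trans x = All (Imp (Rel MemI [0, x + 1])
     (All (Imp (Rel MemI [0, 1]) (Rel MemI [0, x + 2]))))"

definition fm_ord :: "nat \<Rightarrow> seti_sym fm" where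
  "fm_ord x = And (fm_trans x) (All (Imp (Rel MemI [0, x + 1]) (fm_trans 0)))"

definition ax_cofinal :: "seti_sym fm" where
  "ax_cofinal = And
     (All (Imp (Rel Ind [0]) (fm_ord 0)))
     (All (Imp (fm_ord 0) (Ex (And (Rel Ind [0]) (Rel MemI [1, 0])))))"

text \<open>
  Indiscernibility for \<open>\<phi>(v\<^sub>0, \<dots>, v\<^sub>n\<^sub>-\<^sub>1)\<close>: variables \<open>0, \<dots>, n - 1\<close> and
  \<open>n, \<dots>, 2n - 1\<close> hold the two \<open>\<in>\<close>-increasing sequences.
\<close>

definition ax_indisc :: "nat \<Rightarrow> set_sym fm \<Rightarrow> seti_sym fm" where
  "ax_indisc n \<phi> =
     foldr Imp
       (map (\<lambda>i. Rel Ind [i]) [0..<2 * n]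
        @ map (\<lambda>i. Rel MemI [i, i + 1]) [0..<n - 1]
        @ map (\<lambda>i. Rel MemI [n + i, n + i + 1]) [0..<n - 1])
       (Iff (map_fm (\<lambda>_. MemI) \<phi>) (ren (\<lambda>i. n + i) (map_fm (\<lambda>_. MemI) \<phi>)))"

lemma sat_fm_trans:
  "sat N e (fm_trans x) \<longleftrightarrow>
     (\<forall>y\<in>univ N. rel N MemI [y, e x] \<longrightarrow>
        (\<forall>z\<in>univ N. rel N MemI [z, y] \<longrightarrow> rel N MemI [z, e x]))"
  by (simp add: fm_trans_def)

lemma sat_ax_cofinal:
  fixes N :: "(seti_sym, 'a) fo_struct"
  defines "U \<equiv> univ N"
  defines "mem \<equiv> \<lambda>x y. rel N MemI [x, y]"
  defines "trans_set \<equiv> \<lambda>x. \<forall>y\<in>U. mem y x \<longrightarrow> (\<forall>z\<in>U. mem z y \<longrightarrow> mem z x)"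
  defines "ord \<equiv> \<lambda>x. trans_set x \<and> (\<forall>y\<in>U. mem y x \<longrightarrow> trans_set y)"
  shows "sat N e ax_cofinal \<longleftrightarrow>
    (\<forall>x\<in>U. rel N Ind [x] \<longrightarrow> ord x) \<and>
    (\<forall>x\<in>U. ord x \<longrightarrow> (\<exists>y\<in>U. rel N Ind [y] \<and> mem x y))"
proof -
  have "sat N e (fm_ord x) \<longleftrightarrow> ord (e x)" for e x
    by (simp add: fm_ord_def sat_fm_trans U_def mem_def trans_set_def ord_def)
  then show ?thesis
    unfolding ax_cofinal_def sat.simps sat_connectives by (simp add: U_def mem_def)
qed

lemma sat_foldr_Imp:
  "sat M e (foldr Imp \<phi>s \<psi>) \<longleftrightarrow> ((\<forall>\<phi> \<in> set \<phi>s. sat M e \<phi>) \<longrightarrow> sat M e \<psi>)"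
  by (induction \<phi>s) auto

lemma sat_ax_indisc:
  "sat N e (ax_indisc n \<phi>) \<longleftrightarrow>
     ((\<forall>i < 2 * n. rel N Ind [e i]) \<longrightarrow>
      (\<forall>i < n - 1. rel N MemI [e i, e (i + 1)]) \<longrightarrow>
      (\<forall>i < n - 1. rel N MemI [e (n + i), e (n + i + 1)]) \<longrightarrow>
      (sat N e (map_fm (\<lambda>_. MemI) \<phi>) \<longleftrightarrow> sat N (\<lambda>i. e (n + i)) (map_fm (\<lambda>_. MemI) \<phi>)))"
  unfolding ax_indisc_def sat_foldr_Imp
  by (simp add: ball_Un sat_ren comp_def imp_conjL) (simp add: Ball_def)

definition ZFI :: "seti_sym fm set" where
  "ZFI = ZF_axioms MemI \<union> {ax_cofinal}
     \<union> {ax_indisc n \<phi> |n \<phi>. wf_fm \<phi> \<and> fv \<phi> \<subseteq> {..<n}}"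

section \<open>Parametric interpretations\<close>

text \<open>
  The arguments \<open>xs\<close> occupy the first variables and the parameters \<open>p\<close> the remaining ones. As a
  formula has finitely many free variables, only finitely many parameters matter.
\<close>

definition env :: "'a list \<Rightarrow> (nat \<Rightarrow> 'a) \<Rightarrow> nat \<Rightarrow> 'a" where
  "env xs p k = (if k < length xs then xs ! k else p (k - length xs))"

text \<open>An interpretation of \<^typ>\<open>'s\<close>-structures in \<^typ>\<open>'r\<close>-structures.\<close>

record ('s, 'r) interpretation_fms =
  dom_fm :: "'r fm"
  rel_fm :: "'s \<Rightarrow> 'r fm"

definition par_interpretation ::
    "('r::rel_sym, 'a) fo_struct \<Rightarrow> ('s, 'r) interpretation_fms \<Rightarrow> (nat \<Rightarrow> 'a) \<Rightarrow> bool" where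
  "par_interpretation M J p \<longleftrightarrow>
     wf_fm (dom_fm J) \<and> (\<forall>r. wf_fm (rel_fm J r)) \<and> range p \<subseteq> univ M"

definition interpreted ::
    "('r, 'a) fo_struct \<Rightarrow> ('s, 'r) interpretation_fms \<Rightarrow> (nat \<Rightarrow> 'a) \<Rightarrow> ('s, 'a) fo_struct" where
  "interpreted M J p =
     \<lparr>univ = {a \<in> univ M. sat M (env [a] p) (dom_fm J)},
      rel = (\<lambda>r xs. sat M (env xs p) (rel_fm J r))\<rparr>"

definition is_iso ::
    "('a \<Rightarrow> 'b) \<Rightarrow> ('r::rel_sym, 'a) fo_struct \<Rightarrow> ('r, 'b) fo_struct \<Rightarrow> bool" where
  "is_iso f M N \<longleftrightarrow>
     bij_betw f (univ M) (univ N) \<and>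
     (\<forall>r xs. set xs \<subseteq> univ M \<longrightarrow> length xs = arity r \<longrightarrow>
        (rel M r xs \<longleftrightarrow> rel N r (map f xs)))"

definition par_definable_map :: "('r::rel_sym, 'a) fo_struct \<Rightarrow> ('a \<Rightarrow> 'a) \<Rightarrow> bool" where
  "par_definable_map M f \<longleftrightarrow>
     (\<exists>\<phi> p. wf_fm \<phi> \<and> range p \<subseteq> univ M \<and>
        (\<forall>x \<in> univ M. \<forall>y \<in> univ M. f x = y \<longleftrightarrow> sat M (env [x, y] p) \<phi>))"

text \<open>
  The parameters \<open>p\<close> of the interpretation \<open>I\<close> live in \<open>N\<close>; to apply \<open>I\<close> inside the copy of \<open>N\<close>
  interpreted in \<open>M\<close> they are transported along an isomorphism \<open>j\<close> onto that copy, and likewise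
  for \<open>J\<close>.
\<close>

definition par_bi_interpretable ::
    "('r::rel_sym, 'a) fo_struct \<Rightarrow> ('s::rel_sym, 'b) fo_struct \<Rightarrow> bool" where
  "par_bi_interpretable M N \<longleftrightarrow>
     (\<exists>I p J q i j F G.
        par_interpretation N I p \<and> is_iso i M (interpreted N I p) \<and>
        par_interpretation M J q \<and> is_iso j N (interpreted M J q) \<and>
        par_definable_map M F \<and>
        is_iso F M (interpreted (interpreted M J q) I (j \<circ> p)) \<and>
        par_definable_map N G \<and>
        is_iso G N (interpreted (interpreted N I p) J (i \<circ> q)))"

end

theory Submission
  imports Defs
begin

text \<open>
  Let \<open>N'\<close> be the copy of \<open>N\<close> interpreted in \<open>M\<close>, and \<open>M\<^sup>*\<close> the copy of \<open>M\<close> interpreted in \<open>N'\<close>,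
  with an \<open>M\<close>-definable isomorphism \<open>F\<close> from \<open>M\<close> to \<open>M\<^sup>*\<close>. As \<open>M\<^sup>*\<close> is well-founded for
  classes definable in \<open>N'\<close>, the model \<open>N'\<close> can compare itself with \<open>M\<^sup>*\<close> by set-sized
  bisimulations. All of \<open>M\<^sup>*\<close> is matched with a transitive part of \<open>N'\<close>, since otherwise \<open>N'\<close>, hence
  also \<open>M\<^sup>*\<close>, would be a set in \<open>M\<close>; and this part has unbounded rank in \<open>N'\<close>, since otherwise
  \<open>M\<^sup>*\<close>, hence also \<open>N'\<close>, would be a set in \<open>N'\<close>. Therefore \<open>M\<close> sees \<open>N'\<close> as set-like and
  well-founded, and by induction the matched part is all of \<open>N'\<close>: there is an \<open>M\<close>-definable
  \<open>\<in>\<close>-isomorphism from \<open>M\<close> onto \<open>N'\<close>.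

  Consequently the class \<open>I\<close> of indiscernibles is definable in the \<open>\<in>\<close>-reduct of \<open>N'\<close> from a parameter
  \<open>a\<close>, say by \<open>Q(\<cdot>, a)\<close>. For \<open>\<alpha> < x < y\<close> in \<open>I\<close> consider the statement that for all \<open>z\<close> of rank at
  most that of \<open>\<alpha>\<close>, \<open>Q(\<cdot>, z)\<close> meets the interval \<open>(\<alpha>, x)\<close> iff it meets \<open>(\<alpha>, y)\<close>. By collection it
  holds for all large \<open>x\<close> and \<open>y\<close>, but it fails at \<open>z = a\<close> for the first two elements of \<open>I\<close> above a
  large \<open>\<alpha>\<close>.
\<close>

section \<open>Definable predicates\<close>

text \<open>The possible fillings of an argument place, as functions of the environment: a variable
  or a parameter from \<open>P\<close>. The languages are relational, so compound terms do not
  arise.\<close>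

definition trm :: "'a set \<Rightarrow> ((nat \<Rightarrow> 'a) \<Rightarrow> 'a) \<Rightarrow> bool" where
  "trm P t \<longleftrightarrow> (\<exists>i. t = (\<lambda>e. e i)) \<or> (\<exists>a \<in> P. t = (\<lambda>e. a))"

named_theorems dfn

lemma trm_var [dfn]: "trm P (\<lambda>e. e i)"
  by (auto simp: trm_def)

lemma trm_const [dfn]: "a \<in> P \<Longrightarrow> trm P (\<lambda>e. a)"
  by (auto simp: trm_def)

lemma trm_subst: "trm P s \<Longrightarrow> (\<And>i. trm P (t i)) \<Longrightarrow> trm P (\<lambda>e. s (\<lambda>i. t i e))"
  by (auto simp: trm_def)

lemma trm_shift: "trm P s \<Longrightarrow> trm P (\<lambda>e. s (\<lambda>i. e (Suc i)))"
  by (auto simp: trm_def)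

lemma trm_in: "trm P t \<Longrightarrow> P \<subseteq> U \<Longrightarrow> range e \<subseteq> U \<Longrightarrow> t e \<in> U"
  by (auto simp: trm_def)

text \<open>\<open>D\<close> abstracts the class of predicates definable with parameters from
  \<open>P\<close>. Working with HOL predicates instead of formulas lets the rules
  \<open>dfn\<close> prove definability by following the shape of a statement. In
  \<open>D_all\<close> the bound variable takes position 0 and the others move up by one.\<close>

locale definability =
  fixes U :: "'a set" and mem :: "'a \<Rightarrow> 'a \<Rightarrow> bool" (infix "\<sqin>" 50)
    and P :: "'a set" and D :: "((nat \<Rightarrow> 'a) \<Rightarrow> bool) \<Rightarrow> bool"
  assumes mem_U: "x \<sqin> y \<Longrightarrow> x \<in> U \<and> y \<in> U"
    and P_sub: "P \<subseteq> U"
    and D_cong: "D R \<Longrightarrow> (\<And>e. range e \<subseteq> U \<Longrightarrow> R e = R' e) \<Longrightarrow> D R'"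
    and D_subst: "D R \<Longrightarrow> (\<And>i. trm P (t i)) \<Longrightarrow> D (\<lambda>e. R (\<lambda>i. t i e))"
    and D_eq0: "D (\<lambda>e. e 0 = e 1)"
    and D_mem0: "D (\<lambda>e. e 0 \<sqin> e 1)"
    and D_not [dfn]: "D R \<Longrightarrow> D (\<lambda>e. \<not> R e)"
    and D_conj [dfn]: "D R \<Longrightarrow> D R' \<Longrightarrow> D (\<lambda>e. R e \<and> R' e)"
    and D_all [dfn]: "D (\<lambda>e. Q (e 0) (\<lambda>i. e (Suc i))) \<Longrightarrow> D (\<lambda>e. \<forall>x \<in> U. Q x e)"
begin

lemma D_disj [dfn]:
  assumes "D R" "D R'"
  shows "D (\<lambda>e. R e \<or> R' e)"
proof -
  have "D (\<lambda>e. \<not> (\<not> R e \<and> \<not> R' e))" by (intro D_not D_conj assms)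
  then show ?thesis by (rule D_cong) blast
qed

lemma D_imp [dfn]:
  assumes "D R" "D R'"
  shows "D (\<lambda>e. R e \<longrightarrow> R' e)"
proof -
  have "D (\<lambda>e. \<not> R e \<or> R' e)" by (intro D_not D_disj assms)
  then show ?thesis by (rule D_cong) blast
qed

lemma D_iff [dfn]:
  assumes "D R" "D R'"
  shows "D (\<lambda>e. R e \<longleftrightarrow> R' e)"
proof -
  have "D (\<lambda>e. (R e \<longrightarrow> R' e) \<and> (R' e \<longrightarrow> R e))" by (intro D_imp D_conj assms)
  then show ?thesis by (rule D_cong) blast
qed

lemma D_ex [dfn]:
  assumes "D (\<lambda>e. Q (e 0) (\<lambda>i. e (Suc i)))"
  shows "D (\<lambda>e. \<exists>x \<in> U. Q x e)"
proof -
  have "D (\<lambda>e. \<not> (\<forall>x \<in> U. \<not> Q x e))" by (intro D_not D_all assms)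
  then show ?thesis by (rule D_cong) blast
qed

lemma D_subst1: "D (\<lambda>e. R (e 0)) \<Longrightarrow> trm P s \<Longrightarrow> D (\<lambda>e. R (s e))"
  using D_subst[of "\<lambda>e. R (e 0)" "\<lambda>_. s"] by simp

lemma D_subst2:
  "D (\<lambda>e. R (e 0) (e 1)) \<Longrightarrow> trm P s \<Longrightarrow> trm P t \<Longrightarrow> D (\<lambda>e. R (s e) (t e))"
  using D_subst[of "\<lambda>e. R (e 0) (e 1)" "\<lambda>i. if i = 0 then s else t"] by simp

lemma D_eq [dfn]: "trm P s \<Longrightarrow> trm P t \<Longrightarrow> D (\<lambda>e. s e = t e)"
  by (rule D_subst2[OF D_eq0])

lemma D_mem [dfn]: "trm P s \<Longrightarrow> trm P t \<Longrightarrow> D (\<lambda>e. s e \<sqin> t e)"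
  by (rule D_subst2[OF D_mem0])

lemma D_ball_mem [dfn]:
  assumes "trm P s" "D (\<lambda>e. Q (e 0) (\<lambda>i. e (Suc i)))"
  shows "D (\<lambda>e. \<forall>x. x \<sqin> s e \<longrightarrow> Q x e)"
proof -
  have "D (\<lambda>e. \<forall>x \<in> U. x \<sqin> s e \<longrightarrow> Q x e)"
    by (intro D_all D_imp D_mem trm_var trm_shift assms)
  then show ?thesis by (rule D_cong) (use mem_U in blast)
qed

lemma D_bex_mem [dfn]:
  assumes "trm P s" "D (\<lambda>e. Q (e 0) (\<lambda>i. e (Suc i)))"
  shows "D (\<lambda>e. \<exists>x. x \<sqin> s e \<and> Q x e)"
proof -
  have "D (\<lambda>e. \<exists>x \<in> U. x \<sqin> s e \<and> Q x e)"
    by (intro D_ex D_conj D_mem trm_var trm_shift assms)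
  then show ?thesis by (rule D_cong) (use mem_U in blast)
qed

definition is_upair :: "'a \<Rightarrow> 'a \<Rightarrow> 'a \<Rightarrow> bool" where
  "is_upair z x y \<longleftrightarrow> (\<forall>w \<in> U. w \<sqin> z \<longleftrightarrow> w = x \<or> w = y)"

text \<open>The Kuratowski pair, as a relation since the language has no terms for it.\<close>

definition is_pair :: "'a \<Rightarrow> 'a \<Rightarrow> 'a \<Rightarrow> bool" where
  "is_pair z x y \<longleftrightarrow> (\<exists>a \<in> U. \<exists>b \<in> U. is_upair a x x \<and> is_upair b x y \<and> is_upair z a b)"

definition related :: "'a \<Rightarrow> 'a \<Rightarrow> 'a \<Rightarrow> bool" where
  "related f x y \<longleftrightarrow> (\<exists>z. z \<sqin> f \<and> is_pair z x y)"

definition closed_under :: "('a \<Rightarrow> 'a \<Rightarrow> ('a \<Rightarrow> 'a \<Rightarrow> bool) \<Rightarrow> bool) \<Rightarrow> 'a \<Rightarrow> bool" where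
  "closed_under \<Theta> f \<longleftrightarrow> (\<forall>u \<in> U. \<forall>v \<in> U. related f u v \<longrightarrow> \<Theta> u v (related f))"

text \<open>
  A first-order substitute for recursion: the union of all set-sized relations \<open>f\<close> that are
  post-fixed points of the operator \<open>\<Theta>\<close>.
\<close>

definition corec_rel :: "('a \<Rightarrow> 'a \<Rightarrow> ('a \<Rightarrow> 'a \<Rightarrow> bool) \<Rightarrow> bool) \<Rightarrow> 'a \<Rightarrow> 'a \<Rightarrow> bool" where
  "corec_rel \<Theta> x y \<longleftrightarrow> (\<exists>f \<in> U. closed_under \<Theta> f \<and> related f x y)"

text \<open>The greatest simulation of membership by itself, which compares von Neumann ranks.\<close>

definition rank_le :: "'a \<Rightarrow> 'a \<Rightarrow> bool" where
  "rank_le = corec_rel (\<lambda>u v X. \<forall>x. x \<sqin> u \<longrightarrow> (\<exists>y. y \<sqin> v \<and> X x y))"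

definition ordinal :: "'a \<Rightarrow> bool" where
  "ordinal x \<longleftrightarrow> (\<forall>y. y \<sqin> x \<longrightarrow> (\<forall>z. z \<sqin> y \<longrightarrow> z \<sqin> x)) \<and>
     (\<forall>w. w \<sqin> x \<longrightarrow> (\<forall>y. y \<sqin> w \<longrightarrow> (\<forall>z. z \<sqin> y \<longrightarrow> z \<sqin> w)))"

lemma ordinal_mem: "y \<sqin> x \<Longrightarrow> ordinal x \<Longrightarrow> ordinal y"
  unfolding ordinal_def by blast

lemma ordinal_trans: "z \<sqin> y \<Longrightarrow> y \<sqin> x \<Longrightarrow> ordinal x \<Longrightarrow> z \<sqin> x"
  unfolding ordinal_def by blast

lemma ordinalI:
  assumes "\<And>y z. z \<sqin> y \<Longrightarrow> y \<sqin> x \<Longrightarrow> z \<sqin> x" "\<And>y. y \<sqin> x \<Longrightarrow> ordinal y"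
  shows "ordinal x"
  unfolding ordinal_def using assms(1) ordinal_trans[OF _ _ assms(2)] by blast

lemma D_subst3:
  assumes "D (\<lambda>e. R (e 0) (e 1) (e 2))" "trm P r" "trm P s" "trm P t"
  shows "D (\<lambda>e. R (r e) (s e) (t e))"
  using D_subst[OF assms(1), of "\<lambda>i. if i = 0 then r else if i = 1 then s else t"] assms(2-)
  by simp

lemma D_is_upair [dfn]: "trm P r \<Longrightarrow> trm P s \<Longrightarrow> trm P t \<Longrightarrow> D (\<lambda>e. is_upair (r e) (s e) (t e))"
  by (rule D_subst3) (unfold is_upair_def, intro dfn)

lemma D_is_pair [dfn]: "trm P r \<Longrightarrow> trm P s \<Longrightarrow> trm P t \<Longrightarrow> D (\<lambda>e. is_pair (r e) (s e) (t e))"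
  by (rule D_subst3) (unfold is_pair_def, intro dfn)

lemma D_related [dfn]: "trm P r \<Longrightarrow> trm P s \<Longrightarrow> trm P t \<Longrightarrow> D (\<lambda>e. related (r e) (s e) (t e))"
  by (rule D_subst3) (unfold related_def, intro dfn)

lemma D_corec_rel:
  assumes "D (\<lambda>e. closed_under \<Theta> (e 0))" "trm P s" "trm P t"
  shows "D (\<lambda>e. corec_rel \<Theta> (s e) (t e))"
proof (rule D_subst2[OF _ assms(2,3)])
  show "D (\<lambda>e. corec_rel \<Theta> (e 0) (e 1))"
    unfolding corec_rel_def by (intro dfn D_subst1[OF assms(1)])
qed

lemma D_closed_rank_le: "D (\<lambda>e. closed_under (\<lambda>u v X. \<forall>x. x \<sqin> u \<longrightarrow> (\<exists>y. y \<sqin> v \<and> X x y)) (e 0))"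
  unfolding closed_under_def by (intro dfn)

lemma D_rank_le [dfn]: "trm P s \<Longrightarrow> trm P t \<Longrightarrow> D (\<lambda>e. rank_le (s e) (t e))"
  unfolding rank_le_def by (rule D_corec_rel[OF D_closed_rank_le])

lemma D_ordinal [dfn]: "trm P s \<Longrightarrow> D (\<lambda>e. ordinal (s e))"
  by (rule D_subst1) (unfold ordinal_def, intro dfn)

end

text \<open>ZF in semantic form: separation and collection range over \<open>D\<close> with all of
  \<open>U\<close> as parameters, and \<open>D\<close> may contain more than what is definable from
  membership.\<close>

locale zf_world = definability U mem U D
  for U :: "'a set" and mem (infix "\<sqin>" 50) and D +
  assumes ext: "x \<in> U \<Longrightarrow> y \<in> U \<Longrightarrow> (\<And>z. z \<sqin> x \<longleftrightarrow> z \<sqin> y) \<Longrightarrow> x = y"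
    and foundation: "y \<sqin> x \<Longrightarrow> \<exists>y. y \<sqin> x \<and> (\<forall>z. z \<sqin> x \<longrightarrow> \<not> z \<sqin> y)"
    and pairing: "x \<in> U \<Longrightarrow> y \<in> U \<Longrightarrow> \<exists>z. x \<sqin> z \<and> y \<sqin> z"
    and union: "x \<in> U \<Longrightarrow> \<exists>u \<in> U. \<forall>y z. z \<sqin> y \<longrightarrow> y \<sqin> x \<longrightarrow> z \<sqin> u"
    and power: "x \<in> U \<Longrightarrow> \<exists>p \<in> U. \<forall>y \<in> U. (\<forall>z. z \<sqin> y \<longrightarrow> z \<sqin> x) \<longrightarrow> y \<sqin> p"
    and infinity: "\<exists>x. (\<exists>y. y \<sqin> x \<and> (\<forall>z. \<not> z \<sqin> y)) \<and>
          (\<forall>y. y \<sqin> x \<longrightarrow> (\<exists>w. w \<sqin> x \<and> (\<forall>z. z \<sqin> w \<longleftrightarrow> z \<sqin> y \<or> z = y)))"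
    and separation: "D (\<lambda>e. Q (e 0)) \<Longrightarrow> a \<in> U \<Longrightarrow> \<exists>b \<in> U. \<forall>x. x \<sqin> b \<longleftrightarrow> x \<sqin> a \<and> Q x"
    and collection: "D (\<lambda>e. R (e 0) (e 1)) \<Longrightarrow> a \<in> U \<Longrightarrow>
          (\<And>x. x \<sqin> a \<Longrightarrow> \<exists>y \<in> U. R x y) \<Longrightarrow>
          \<exists>b \<in> U. \<forall>x. x \<sqin> a \<longrightarrow> (\<exists>y. y \<sqin> b \<and> R x y)"
begin

section \<open>Small classes, pairs and set-sized relations\<close>

definition small :: "('a \<Rightarrow> bool) \<Rightarrow> bool" where
  "small X \<longleftrightarrow> (\<exists>b \<in> U. \<forall>x \<in> U. X x \<longrightarrow> x \<sqin> b)"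

lemma small_subclass: "small X \<Longrightarrow> (\<And>x. x \<in> U \<Longrightarrow> Y x \<Longrightarrow> X x) \<Longrightarrow> small Y"
  unfolding small_def by blast

lemma small_mem: "a \<in> U \<Longrightarrow> small (\<lambda>x. x \<sqin> a)"
  unfolding small_def by blast

text \<open>Separation cuts the bound down to the class itself; this is where definability of
  \<open>X\<close> enters, as \<open>small\<close> asks only for a bound.\<close>

lemma small_set:
  assumes "small X" "D (\<lambda>e. X (e 0))"
  obtains b where "b \<in> U" "\<And>x. x \<sqin> b \<longleftrightarrow> x \<in> U \<and> X x"
proof -
  obtain c where c: "c \<in> U" "\<forall>x \<in> U. X x \<longrightarrow> x \<sqin> c" using assms(1) by (auto simp: small_def)
  with separation[OF assms(2) c(1)] mem_U that show thesis by metis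
qed

text \<open>Collection gathers bounds for the classes \<open>X x\<close> into a set, whose union
  bounds them all.\<close>

lemma small_UN:
  assumes a: "a \<in> U" and D: "D (\<lambda>e. X (e 0) (e 1))" and small: "\<And>x. x \<sqin> a \<Longrightarrow> small (X x)"
  shows "small (\<lambda>y. \<exists>x. x \<sqin> a \<and> X x y)"
proof -
  have "D (\<lambda>e. \<forall>y \<in> U. X (e 0) y \<longrightarrow> y \<sqin> e 1)"
    by (intro dfn D_subst2[OF D])
  from collection[OF this a] small obtain b
    where b: "b \<in> U" "\<forall>x. x \<sqin> a \<longrightarrow> (\<exists>c. c \<sqin> b \<and> (\<forall>y \<in> U. X x y \<longrightarrow> y \<sqin> c))"
    unfolding small_def by blast
  with union[OF b(1)] show ?thesis unfolding small_def by metis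
qed

text \<open>Pairing puts the possible element into a set; infinity supplies some set in case the
  class is empty.\<close>

lemma small_at_most_one: "(\<And>x y. x \<in> U \<Longrightarrow> y \<in> U \<Longrightarrow> X x \<Longrightarrow> X y \<Longrightarrow> x = y) \<Longrightarrow> small X"
  unfolding small_def using pairing infinity mem_U by metis

lemma small_disj:
  assumes "small X" "small Y"
  shows "small (\<lambda>x. X x \<or> Y x)"
proof -
  obtain a b where ab: "a \<in> U" "b \<in> U" "\<forall>x \<in> U. X x \<longrightarrow> x \<sqin> a" "\<forall>x \<in> U. Y x \<longrightarrow> x \<sqin> b"
    using assms unfolding small_def by blast
  obtain c where c: "a \<sqin> c" "b \<sqin> c" using pairing ab by blast
  with union[of c] mem_U ab show ?thesis unfolding small_def by metis
qed

lemma small_eq: "small (\<lambda>x. x = a)"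
  by (rule small_at_most_one) simp

lemma upair_ex: "x \<in> U \<Longrightarrow> y \<in> U \<Longrightarrow> \<exists>z \<in> U. is_upair z x y"
  unfolding is_upair_def
  by (rule small_set[OF small_disj[OF small_eq[of x] small_eq[of y]]]) (auto intro!: dfn)

lemma is_upair_iff:
  "is_upair z x y \<Longrightarrow> x \<in> U \<Longrightarrow> y \<in> U \<Longrightarrow> w \<sqin> z \<longleftrightarrow> w = x \<or> w = y"
  unfolding is_upair_def using mem_U by blast

lemma pair_ex: "x \<in> U \<Longrightarrow> y \<in> U \<Longrightarrow> \<exists>z \<in> U. is_pair z x y"
  unfolding is_pair_def using upair_ex by metis

lemma is_pair_inject:
  assumes "is_pair z x y" "is_pair z x' y'" and U: "x \<in> U" "y \<in> U" "x' \<in> U" "y' \<in> U"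
  shows "x = x' \<and> y = y'"
proof -
  obtain a b where ab: "a \<in> U" "b \<in> U" "is_upair a x x" "is_upair b x y" "is_upair z a b"
    using assms(1) unfolding is_pair_def by blast
  obtain a' b' where ab': "a' \<in> U" "b' \<in> U" "is_upair a' x' x'" "is_upair b' x' y'" "is_upair z a' b'"
    using assms(2) unfolding is_pair_def by blast
  have "a = a' \<or> a = b'" "b = a' \<or> b = b'" "a' = a \<or> a' = b" "b' = a \<or> b' = b"
    using is_upair_iff ab(1,2,5) ab'(1,2,5) by metis+
  moreover have "w \<sqin> a \<longleftrightarrow> w = x" "w \<sqin> b \<longleftrightarrow> w = x \<or> w = y"
    "w \<sqin> a' \<longleftrightarrow> w = x'" "w \<sqin> b' \<longleftrightarrow> w = x' \<or> w = y'" for w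
    using is_upair_iff[OF ab(3)] is_upair_iff[OF ab(4)] is_upair_iff[OF ab'(3)] is_upair_iff[OF ab'(4)] U
    by auto
  ultimately show ?thesis by metis
qed

text \<open>Collection yields a set of pairs; keeping every pair in it that satisfies
  \<open>R\<close> gives a total but possibly multivalued relation on \<open>a\<close>, so no choice
  is involved.\<close>

lemma related_set:
  assumes D: "D (\<lambda>e. R (e 0) (e 1))" and a: "a \<in> U" and ex: "\<And>x. x \<sqin> a \<Longrightarrow> \<exists>y \<in> U. R x y"
  obtains f where "f \<in> U" "\<And>x y. x \<in> U \<Longrightarrow> y \<in> U \<Longrightarrow> related f x y \<Longrightarrow> x \<sqin> a \<and> R x y"
    "\<And>x. x \<sqin> a \<Longrightarrow> \<exists>y \<in> U. related f x y"
proof -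
  have "D (\<lambda>e. \<exists>y \<in> U. is_pair (e 1) (e 0) y \<and> R (e 0) y)"
    by (intro dfn D_subst2[OF D])
  from collection[OF this a] ex pair_ex mem_U obtain b
    where b: "b \<in> U" "\<And>x. x \<sqin> a \<Longrightarrow> \<exists>z. z \<sqin> b \<and> (\<exists>y \<in> U. is_pair z x y \<and> R x y)"
    by metis
  have "D (\<lambda>e. \<exists>x. x \<sqin> a \<and> (\<exists>y \<in> U. is_pair (e 0) x y \<and> R x y))"
    by (intro dfn D_subst2[OF D] a)
  from separation[OF this b(1)] obtain f
    where f: "f \<in> U" "\<And>z. z \<sqin> f \<longleftrightarrow> z \<sqin> b \<and> (\<exists>x. x \<sqin> a \<and> (\<exists>y \<in> U. is_pair z x y \<and> R x y))"
    by blast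
  show thesis
  proof
    show "f \<in> U" by fact
    show "x \<sqin> a \<and> R x y" if "x \<in> U" "y \<in> U" "related f x y" for x y
      using that is_pair_inject mem_U unfolding related_def f(2) by metis
    show "\<exists>y \<in> U. related f x y" if "x \<sqin> a" for x
      using that b(2) unfolding related_def f(2) by blast
  qed
qed

section \<open>Unions of set-sized post-fixed points\<close>

definition mono_op :: "('a \<Rightarrow> 'a \<Rightarrow> ('a \<Rightarrow> 'a \<Rightarrow> bool) \<Rightarrow> bool) \<Rightarrow> bool" where
  "mono_op \<Theta> \<longleftrightarrow> (\<forall>X Y. (\<forall>u \<in> U. \<forall>v \<in> U. X u v \<longrightarrow> Y u v) \<longrightarrow>
     (\<forall>x \<in> U. \<forall>y \<in> U. \<Theta> x y X \<longrightarrow> \<Theta> x y Y))"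

lemma mono_opD:
  "mono_op \<Theta> \<Longrightarrow> \<Theta> x y X \<Longrightarrow> x \<in> U \<Longrightarrow> y \<in> U \<Longrightarrow>
    (\<And>u v. u \<in> U \<Longrightarrow> v \<in> U \<Longrightarrow> X u v \<Longrightarrow> Y u v) \<Longrightarrow> \<Theta> x y Y"
  unfolding mono_op_def by blast

text \<open>By monotonicity a union of post-fixed points is again one.\<close>

lemma corec_rel_unfold:
  assumes mono: "mono_op \<Theta>" and "corec_rel \<Theta> x y" "x \<in> U" "y \<in> U"
  shows "\<Theta> x y (corec_rel \<Theta>)"
proof -
  obtain f where f: "f \<in> U" "closed_under \<Theta> f" "related f x y"
    using assms(2) unfolding corec_rel_def by blast
  then have "\<Theta> x y (related f)" using assms(3,4) unfolding closed_under_def by blast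
  then show ?thesis by (rule mono_opD[OF mono]) (use assms f in \<open>auto simp: corec_rel_def\<close>)
qed

text \<open>For this converse of \<open>corec_rel_unfold\<close> the instances used by the step must
  form a set \<open>w\<close>: collection then finds set-sized post-fixed points for all pairs in
  \<open>w\<close>, and their union together with the new pair is again a post-fixed point.\<close>

lemma corec_rel_fold:
  assumes mono: "mono_op \<Theta>" and D: "D (\<lambda>e. closed_under \<Theta> (e 0))"
    and U: "x \<in> U" "y \<in> U" "w \<in> U"
    and step: "\<Theta> x y (related w)"
    and w: "\<And>u v. u \<in> U \<Longrightarrow> v \<in> U \<Longrightarrow> related w u v \<Longrightarrow> corec_rel \<Theta> u v"
  shows "corec_rel \<Theta> x y"
proof -
  have D': "D (\<lambda>e. \<forall>u \<in> U. \<forall>v \<in> U. is_pair (e 0) u v \<longrightarrow> closed_under \<Theta> (e 1) \<and> related (e 1) u v)"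
    by (intro dfn D_subst1[OF D])
  \<comment> \<open>Members of \<open>w\<close> that are not pairs meet the condition vacuously, so
    collection can run over all of \<open>w\<close>.\<close>
  have ex: "\<exists>f \<in> U. \<forall>u \<in> U. \<forall>v \<in> U. is_pair z u v \<longrightarrow> closed_under \<Theta> f \<and> related f u v"
    if "z \<sqin> w" for z
  proof (cases "\<exists>u \<in> U. \<exists>v \<in> U. is_pair z u v")
    case True
    then obtain u v where uv: "u \<in> U" "v \<in> U" "is_pair z u v" by blast
    with that w have "corec_rel \<Theta> u v" unfolding related_def by blast
    then show ?thesis using is_pair_inject uv unfolding corec_rel_def by metis
  qed (use U in blast)
  from collection[OF D' U(3) ex] obtain b where b: "b \<in> U" "\<And>z. z \<sqin> w \<Longrightarrow> \<exists>f. f \<sqin> b \<and>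
      (\<forall>u \<in> U. \<forall>v \<in> U. is_pair z u v \<longrightarrow> closed_under \<Theta> f \<and> related f u v)"
    by blast
  obtain p where p: "p \<in> U" "is_pair p x y" using pair_ex U by blast
  \<comment> \<open>The set \<open>g\<close> obtained from this class is the union of the post-fixed
    points in \<open>b\<close> with the new pair \<open>p\<close>.\<close>
  have "small (\<lambda>z. (\<exists>f. f \<sqin> b \<and> z \<sqin> f \<and> closed_under \<Theta> f) \<or> z = p)"
  proof (intro small_disj small_eq)
    have "small (\<lambda>z. \<exists>f. f \<sqin> b \<and> z \<sqin> f)"
      by (rule small_UN[OF b(1)]) (use mem_U in \<open>auto intro!: dfn small_mem\<close>)
    then show "small (\<lambda>z. \<exists>f. f \<sqin> b \<and> z \<sqin> f \<and> closed_under \<Theta> f)"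
      by (rule small_subclass) blast
  qed
  moreover have "D (\<lambda>e. (\<exists>f. f \<sqin> b \<and> e 0 \<sqin> f \<and> closed_under \<Theta> f) \<or> e 0 = p)"
    by (intro dfn D_subst1[OF D] b p)
  ultimately obtain g
    where g: "g \<in> U" "\<And>z. z \<sqin> g \<longleftrightarrow> z \<in> U \<and> ((\<exists>f. f \<sqin> b \<and> z \<sqin> f \<and> closed_under \<Theta> f) \<or> z = p)"
    by (rule small_set) blast
  have sub: "related g u v" if "f \<sqin> b" "closed_under \<Theta> f" "related f u v" for f u v
    using that mem_U unfolding related_def g(2) by blast
  have w_sub: "related g u v" if "related w u v" "u \<in> U" "v \<in> U" for u v
    using that b(2) sub unfolding related_def by metis
  have "closed_under \<Theta> g" unfolding closed_under_def
  proof (intro ballI impI)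
    fix u v assume uv: "u \<in> U" "v \<in> U" "related g u v"
    then obtain z where z: "z \<sqin> g" "is_pair z u v" unfolding related_def by blast
    show "\<Theta> u v (related g)"
    proof (cases "z = p")
      case True
      then have "u = x" "v = y" using is_pair_inject z p U uv by metis+
      with mono_opD[OF mono step] U w_sub show ?thesis by blast
    next
      case False
      then obtain f where f: "f \<sqin> b" "closed_under \<Theta> f" "related f u v"
        using z g(2) unfolding related_def by blast
      then have "\<Theta> u v (related f)" using uv unfolding closed_under_def by blast
      then show ?thesis by (rule mono_opD[OF mono]) (use uv f sub in auto)
    qed
  qed
  moreover have "related g x y" unfolding related_def g(2) using p by blast
  ultimately show ?thesis using g(1) unfolding corec_rel_def by blast
qed

section \<open>Natural numbers, transitive supersets and membership induction\<close>

lemma no_cycle2: "x \<sqin> y \<Longrightarrow> \<not> y \<sqin> x"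
proof
  assume x: "x \<sqin> y" "y \<sqin> x"
  obtain s where s: "s \<in> U" "is_upair s x y" using upair_ex mem_U x by blast
  then have *: "w \<sqin> s \<longleftrightarrow> w = x \<or> w = y" for w using is_upair_iff mem_U x by blast
  obtain z where "z \<sqin> s" "\<And>w. w \<sqin> s \<Longrightarrow> \<not> w \<sqin> z" using foundation[of x s] * by blast
  then show False using x unfolding * by blast
qed

lemma no_cycle1: "\<not> x \<sqin> x"
  using no_cycle2 by blast

lemma not_small_U: "\<not> small (\<lambda>x. True)"
  unfolding small_def using no_cycle1 by blast

lemma empty_set: "\<exists>z \<in> U. \<forall>w. \<not> w \<sqin> z"
  using infinity mem_U by blast

definition is_suc :: "'a \<Rightarrow> 'a \<Rightarrow> bool" where
  "is_suc s n \<longleftrightarrow> (\<forall>z \<in> U. z \<sqin> s \<longleftrightarrow> z \<sqin> n \<or> z = n)"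

lemma D_is_suc [dfn]: "trm U s \<Longrightarrow> trm U t \<Longrightarrow> D (\<lambda>e. is_suc (s e) (t e))"
  by (rule D_subst2) (unfold is_suc_def, intro dfn)

text \<open>The clause \<open>x \<noteq> x\<close> expresses falsity in a form covered by the definability rules.\<close>

definition natural :: "'a \<Rightarrow> bool" where
  "natural n \<longleftrightarrow> (\<forall>w \<in> U. (\<forall>z \<in> U. (\<forall>x. x \<sqin> z \<longrightarrow> x \<noteq> x) \<longrightarrow> z \<sqin> w) \<longrightarrow>
     (\<forall>y. y \<sqin> w \<longrightarrow> (\<forall>s \<in> U. is_suc s y \<longrightarrow> s \<sqin> w)) \<longrightarrow> n \<sqin> w)"

lemma D_natural [dfn]: "trm U s \<Longrightarrow> D (\<lambda>e. natural (s e))"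
  by (rule D_subst1) (unfold natural_def, intro dfn)

lemma suc_inject: "is_suc s m \<Longrightarrow> is_suc s n \<Longrightarrow> m \<in> U \<Longrightarrow> n \<in> U \<Longrightarrow> m = n"
  unfolding is_suc_def using no_cycle2 by blast

lemma suc_ex: "n \<in> U \<Longrightarrow> \<exists>s \<in> U. is_suc s n"
  unfolding is_suc_def
  by (rule small_set[OF small_disj[OF small_mem[of n] small_eq[of n]]]) (auto intro!: dfn)

text \<open>The set given by infinity is inductive in the sense of \<open>natural\<close>:
  extensionality identifies the empty set and the successors it provides with any others, so it
  contains every natural number.\<close>

lemma small_natural: "small natural"
proof -
  obtain w where w: "\<exists>y. y \<sqin> w \<and> (\<forall>z. \<not> z \<sqin> y)"
    "\<And>y. y \<sqin> w \<Longrightarrow> \<exists>s. s \<sqin> w \<and> (\<forall>z. z \<sqin> s \<longleftrightarrow> z \<sqin> y \<or> z = y)"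
    using infinity by blast
  have "z \<sqin> w" if "z \<in> U" "\<And>x. \<not> x \<sqin> z" for z
    using w(1) that ext mem_U by metis
  moreover have "s \<sqin> w" if y: "y \<sqin> w" and s: "s \<in> U" "is_suc s y" for s y
  proof -
    obtain s' where s': "s' \<sqin> w" "\<And>z. z \<sqin> s' \<longleftrightarrow> z \<sqin> y \<or> z = y" using w(2)[OF y] by blast
    have "s = s'"
      by (rule ext) (use s s' mem_U in \<open>auto simp: is_suc_def\<close>)
    then show ?thesis using s' by simp
  qed
  ultimately have "natural n \<Longrightarrow> n \<sqin> w" for n
    using w(1) mem_U unfolding natural_def by blast
  then show ?thesis using w(1) mem_U unfolding small_def by blast
qed

lemma natural_mem:
  assumes "natural n" "w \<in> U" and "\<And>z. z \<in> U \<Longrightarrow> (\<And>x. \<not> x \<sqin> z) \<Longrightarrow> z \<sqin> w"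
    and "\<And>y s. y \<sqin> w \<Longrightarrow> s \<in> U \<Longrightarrow> is_suc s y \<Longrightarrow> s \<sqin> w"
  shows "n \<sqin> w"
  using assms unfolding natural_def by blast

lemma natural_zero: "z \<in> U \<Longrightarrow> (\<And>x. \<not> x \<sqin> z) \<Longrightarrow> natural z"
  unfolding natural_def by blast

lemma natural_suc: "natural n \<Longrightarrow> s \<in> U \<Longrightarrow> is_suc s n \<Longrightarrow> natural s"
  unfolding natural_def by blast

lemma natural_induct:
  assumes n: "natural n" and D: "D (\<lambda>e. Q (e 0))"
    and zero: "\<And>z. z \<in> U \<Longrightarrow> (\<And>x. \<not> x \<sqin> z) \<Longrightarrow> Q z"
    and suc: "\<And>m s. m \<in> U \<Longrightarrow> s \<in> U \<Longrightarrow> is_suc s m \<Longrightarrow> Q m \<Longrightarrow> Q s"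
  shows "Q n"
proof -
  have "small (\<lambda>n. natural n \<and> Q n)" by (rule small_subclass[OF small_natural]) simp
  moreover have "D (\<lambda>e. natural (e 0) \<and> Q (e 0))" by (intro dfn D)
  ultimately obtain w where w: "w \<in> U" "\<And>x. x \<sqin> w \<longleftrightarrow> x \<in> U \<and> natural x \<and> Q x"
    by (rule small_set) blast
  have "n \<sqin> w"
  proof (rule natural_mem[OF n w(1)])
    show "z \<sqin> w" if "z \<in> U" "\<And>x. \<not> x \<sqin> z" for z
      unfolding w(2) using that natural_zero zero by blast
    show "s \<sqin> w" if "y \<sqin> w" "s \<in> U" "is_suc s y" for y s
      using that natural_suc suc unfolding w(2) by blast
  qed
  then show ?thesis using w(2) by blast
qed

text \<open>Recursion along the natural numbers: level 0 is \<open>x\<close>, each further level is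
  the union of the one before. Every level is small by induction, and collection over the set of
  naturals bounds all levels together.\<close>

lemma transitive_superset:
  assumes x: "x \<in> U"
  shows "\<exists>t \<in> U. (\<forall>y. y \<sqin> x \<longrightarrow> y \<sqin> t) \<and> (\<forall>y z. z \<sqin> y \<longrightarrow> y \<sqin> t \<longrightarrow> z \<sqin> t)"
proof -
  \<comment> \<open>\<open>m\<close> is zero and \<open>v\<close> lies in \<open>x\<close>, or
    \<open>m\<close> is the successor of some \<open>n\<close> and \<open>v\<close> lies in an
    element of level \<open>n\<close>. As in \<open>natural\<close>, the clause
    \<open>z \<noteq> z\<close> stands for falsity.\<close>
  define \<Theta> where "\<Theta> = (\<lambda>m v (X :: 'a \<Rightarrow> 'a \<Rightarrow> bool). ((\<forall>z. z \<sqin> m \<longrightarrow> z \<noteq> z) \<and> v \<sqin> x) \<or>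
     (\<exists>n \<in> U. \<exists>u \<in> U. is_suc m n \<and> X n u \<and> v \<sqin> u))"
  have mono: "mono_op \<Theta>"
    unfolding mono_op_def \<Theta>_def by blast
  have D: "D (\<lambda>e. closed_under \<Theta> (e 0))"
    unfolding closed_under_def \<Theta>_def by (intro dfn x)
  note D_reach [dfn] = D_corec_rel[OF D]
  note unfold = corec_rel_unfold[OF mono]
    and fold = corec_rel_fold[OF mono D]
  have small: "small (corec_rel \<Theta> n)" if "natural n" for n
    using that
  proof (rule natural_induct)
    show "D (\<lambda>e. small (corec_rel \<Theta> (e 0)))" unfolding small_def by (intro dfn)
    show "small (corec_rel \<Theta> z)" if z: "z \<in> U" "\<And>x. \<not> x \<sqin> z" for z
    proof (rule small_subclass[OF small_mem[OF x]])
      fix v assume "v \<in> U" "corec_rel \<Theta> z v"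
      then have "\<Theta> z v (corec_rel \<Theta>)" using unfold z by blast
      then show "v \<sqin> x" using z unfolding \<Theta>_def is_suc_def by blast
    qed
    show "small (corec_rel \<Theta> s)" if s: "m \<in> U" "s \<in> U" "is_suc s m" "small (corec_rel \<Theta> m)" for m s
    proof -
      have "D (\<lambda>e. corec_rel \<Theta> m (e 0))" by (intro dfn s)
      with s(4) obtain b where b: "b \<in> U" "\<And>v. v \<sqin> b \<longleftrightarrow> v \<in> U \<and> corec_rel \<Theta> m v"
        by (rule small_set) blast
      have "small (\<lambda>v. \<exists>u. u \<sqin> b \<and> v \<sqin> u)"
        by (rule small_UN[OF b(1)]) (use mem_U in \<open>auto intro!: dfn small_mem\<close>)
      then show ?thesis
      proof (rule small_subclass)
        fix v assume v: "v \<in> U" "corec_rel \<Theta> s v"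
        then have "\<Theta> s v (corec_rel \<Theta>)" using unfold s by blast
        \<comment> \<open>\<open>s\<close> is nonempty, so only the successor clause of
          \<open>\<Theta>\<close> can apply; by \<open>suc_inject\<close> its \<open>n\<close> is
          \<open>m\<close>.\<close>
        moreover have "m \<sqin> s" using s unfolding is_suc_def by blast
        ultimately obtain n u where "n \<in> U" "u \<in> U" "is_suc s n" "corec_rel \<Theta> n u" "v \<sqin> u"
          unfolding \<Theta>_def by blast
        then show "\<exists>u. u \<sqin> b \<and> v \<sqin> u" using suc_inject s b(2) by blast
      qed
    qed
  qed
  obtain w where w: "w \<in> U" "\<And>n. n \<sqin> w \<longleftrightarrow> n \<in> U \<and> natural n"
    using small_natural by (rule small_set) (auto intro!: dfn)
  have "small (\<lambda>v. \<exists>n. n \<sqin> w \<and> corec_rel \<Theta> n v)"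
    by (rule small_UN[OF w(1)]) (use w(2) small in \<open>auto intro!: dfn\<close>)
  moreover have "D (\<lambda>e. \<exists>n. n \<sqin> w \<and> corec_rel \<Theta> n (e 0))" by (intro dfn w)
  ultimately obtain t where t: "t \<in> U" "\<And>v. v \<sqin> t \<longleftrightarrow> v \<in> U \<and> (\<exists>n. n \<sqin> w \<and> corec_rel \<Theta> n v)"
    by (rule small_set) blast
  obtain z where z: "z \<in> U" "\<And>y. \<not> y \<sqin> z" using empty_set by blast
  have "v \<sqin> t" if "v \<sqin> x" for v
  proof -
    \<comment> \<open>The zero clause makes no recursive call, so the empty set \<open>z\<close>
      also serves as the witness relation.\<close>
    have "corec_rel \<Theta> z v"
    proof (rule fold)
      show "\<Theta> z v (related z)" using z that unfolding \<Theta>_def by blast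
      show "u \<in> U \<Longrightarrow> v \<in> U \<Longrightarrow> related z u v \<Longrightarrow> corec_rel \<Theta> u v" for u v
        using z unfolding related_def by blast
    qed (use z that mem_U in auto)
    then show ?thesis using t w z natural_zero that mem_U by blast
  qed
  moreover have "v \<sqin> t" if v: "v \<sqin> u" "u \<sqin> t" for u v
  proof -
    obtain n where n: "n \<in> U" "natural n" "corec_rel \<Theta> n u" using v t w by blast
    obtain s where s: "s \<in> U" "is_suc s n" using suc_ex n by blast
    obtain p where p: "p \<in> U" "is_pair p n u" using pair_ex n mem_U v by blast
    \<comment> \<open>The successor clause calls only on the pair of \<open>n\<close> and
      \<open>u\<close>, so the singleton of that pair is the witness relation.\<close>
    obtain f where f: "f \<in> U" "is_upair f p p" using upair_ex p by blast
    have rel_f: "related f a b \<longleftrightarrow> a = n \<and> b = u" if "a \<in> U" "b \<in> U" for a b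
      unfolding related_def is_upair_iff[OF f(2) p(1) p(1)]
      using is_pair_inject p n mem_U v that by blast
    have "corec_rel \<Theta> s v"
    proof (rule fold)
      show "\<Theta> s v (related f)" using s v n mem_U rel_f unfolding \<Theta>_def by blast
      show "a \<in> U \<Longrightarrow> b \<in> U \<Longrightarrow> related f a b \<Longrightarrow> corec_rel \<Theta> a b" for a b
        using rel_f n by blast
    qed (use s f v mem_U in auto)
    then show ?thesis using t w natural_suc n s v mem_U by blast
  qed
  ultimately show ?thesis using t(1) by blast
qed

text \<open>Inside a transitive superset \<open>t\<close> of \<open>x\<close> the counterexamples
  form a set. Foundation gives a minimal one, and transitivity of \<open>t\<close> ensures that none
  of its members is a counterexample.\<close>

lemma mem_induct:
  assumes D: "D (\<lambda>e. Q (e 0))" and step: "\<And>x. x \<in> U \<Longrightarrow> (\<And>y. y \<sqin> x \<Longrightarrow> Q y) \<Longrightarrow> Q x"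
    and x: "x \<in> U"
  shows "Q x"
proof (rule ccontr)
  assume nx: "\<not> Q x"
  obtain t where t: "t \<in> U" "\<And>y. y \<sqin> x \<Longrightarrow> y \<sqin> t" "\<And>y z. z \<sqin> y \<Longrightarrow> y \<sqin> t \<Longrightarrow> z \<sqin> t"
    using transitive_superset[OF x] by blast
  obtain b where b: "\<And>y. y \<sqin> b \<longleftrightarrow> y \<sqin> t \<and> \<not> Q y"
    using separation[OF D_not[OF D] t(1)] by blast
  obtain y where "y \<sqin> x" "\<not> Q y" using step[OF x] nx by blast
  then have "y \<sqin> b" using b t by blast
  from foundation[OF this] obtain y where y: "y \<sqin> b" "\<And>z. z \<sqin> b \<Longrightarrow> \<not> z \<sqin> y" by blast
  have "Q z" if "z \<sqin> y" for z using that y b t(3) by blast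
  then have "Q y" using step mem_U[OF y(1)] by blast
  then show False using y b by blast
qed

section \<open>Comparison of ranks, and ordinals\<close>

lemma mono_op_rank_le: "mono_op (\<lambda>u v X. \<forall>x. x \<sqin> u \<longrightarrow> (\<exists>y. y \<sqin> v \<and> X x y))"
  unfolding mono_op_def using mem_U by blast

text \<open>One direction is the post-fixed point property; for the other, collection packs the
  witnesses into the set that \<open>corec_rel_fold\<close> demands.\<close>

lemma rank_le_iff:
  assumes U: "x \<in> U" "y \<in> U"
  shows "rank_le x y \<longleftrightarrow> (\<forall>u. u \<sqin> x \<longrightarrow> (\<exists>v. v \<sqin> y \<and> rank_le u v))"
proof
  assume "rank_le x y"
  then show "\<forall>u. u \<sqin> x \<longrightarrow> (\<exists>v. v \<sqin> y \<and> rank_le u v)"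
    unfolding rank_le_def by (rule corec_rel_unfold[OF mono_op_rank_le _ U])
next
  assume *: "\<forall>u. u \<sqin> x \<longrightarrow> (\<exists>v. v \<sqin> y \<and> rank_le u v)"
  have "D (\<lambda>e. e 1 \<sqin> y \<and> rank_le (e 0) (e 1))" by (intro dfn U)
  from related_set[OF this U(1)] * mem_U obtain w where w: "w \<in> U"
    "\<And>u v. u \<in> U \<Longrightarrow> v \<in> U \<Longrightarrow> related w u v \<Longrightarrow> u \<sqin> x \<and> v \<sqin> y \<and> rank_le u v"
    "\<And>u. u \<sqin> x \<Longrightarrow> \<exists>v \<in> U. related w u v" by metis
  have "\<exists>v. v \<sqin> y \<and> related w u v" if "u \<sqin> x" for u
    using w(2,3) that mem_U by blast
  then have "\<forall>u. u \<sqin> x \<longrightarrow> (\<exists>v. v \<sqin> y \<and> related w u v)" by blast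
  then show "rank_le x y" unfolding rank_le_def
  proof (rule corec_rel_fold[OF mono_op_rank_le D_closed_rank_le U w(1)])
    fix u v assume "u \<in> U" "v \<in> U" "related w u v"
    then show "corec_rel (\<lambda>u v X. \<forall>x. x \<sqin> u \<longrightarrow> (\<exists>y. y \<sqin> v \<and> X x y)) u v"
      using w(2) unfolding rank_le_def by blast
  qed
qed

lemma rank_le_total:
  assumes "x \<in> U" "y \<in> U"
  shows "rank_le x y \<or> rank_le y x"
proof -
  have "\<forall>y \<in> U. rank_le x y \<or> rank_le y x"
  proof (rule mem_induct[where Q = "\<lambda>x. \<forall>y \<in> U. rank_le x y \<or> rank_le y x", OF _ _ assms(1)])
    show "D (\<lambda>e. \<forall>y\<in>U. rank_le (e 0) y \<or> rank_le y (e 0))" by (intro dfn)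
    fix x assume x: "x \<in> U" and IH: "\<And>u. u \<sqin> x \<Longrightarrow> \<forall>y \<in> U. rank_le u y \<or> rank_le y u"
    show "\<forall>y \<in> U. rank_le x y \<or> rank_le y x"
    proof (intro ballI disjCI)
      fix y assume y: "y \<in> U" and "\<not> rank_le y x"
      \<comment> \<open>If \<open>y\<close> is not dominated by \<open>x\<close>, some
        \<open>v\<close> in \<open>y\<close> is dominated by no member of \<open>x\<close>; by the
        induction hypothesis it dominates them all.\<close>
      then obtain v where v: "v \<sqin> y" "\<And>u. u \<sqin> x \<Longrightarrow> \<not> rank_le v u"
        using rank_le_iff[OF y x] by blast
      then have "rank_le u v" if "u \<sqin> x" for u using IH that mem_U by blast
      then show "rank_le x y" unfolding rank_le_iff[OF x y] using v by blast
    qed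
  qed
  then show ?thesis using assms by blast
qed

lemma rank_le_trans:
  assumes "rank_le x y" "rank_le y z" and U: "x \<in> U" "y \<in> U" "z \<in> U"
  shows "rank_le x z"
proof -
  have "\<forall>y \<in> U. \<forall>z \<in> U. rank_le x y \<longrightarrow> rank_le y z \<longrightarrow> rank_le x z" (is "?Q x")
  proof (rule mem_induct[where Q = ?Q, OF _ _ U(1)])
    show "D (\<lambda>e. ?Q (e 0))" by (intro dfn)
    fix x assume x: "x \<in> U" and IH: "\<And>u. u \<sqin> x \<Longrightarrow> ?Q u"
    show "?Q x"
    proof (intro ballI impI)
      fix y z assume yz: "y \<in> U" "z \<in> U" "rank_le x y" "rank_le y z"
      show "rank_le x z" unfolding rank_le_iff[OF x yz(2)]
      proof (intro allI impI)
        fix u assume u: "u \<sqin> x"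
        obtain v where v: "v \<sqin> y" "rank_le u v" using u yz rank_le_iff[OF x yz(1)] by blast
        obtain w where w: "w \<sqin> z" "rank_le v w" using v yz rank_le_iff[OF yz(1,2)] by blast
        show "\<exists>w. w \<sqin> z \<and> rank_le u w" using IH[OF u] v w mem_U by blast
      qed
    qed
  qed
  then show ?thesis using assms by blast
qed

text \<open>By induction on \<open>x\<close>: for \<open>u\<close> in \<open>x\<close> the
  hypothesis gives \<open>rank_le u x\<close>, so \<open>x\<close> itself is the member of
  \<open>y\<close> to compare with.\<close>

lemma mem_rank_le: "x \<sqin> y \<Longrightarrow> rank_le x y"
proof -
  assume xy: "x \<sqin> y"
  have "\<forall>y. y \<in> U \<longrightarrow> x \<sqin> y \<longrightarrow> rank_le x y"
  proof (rule mem_induct[where Q = "\<lambda>x. \<forall>y. y \<in> U \<longrightarrow> x \<sqin> y \<longrightarrow> rank_le x y"])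
    have "D (\<lambda>e. \<forall>y\<in>U. e 0 \<sqin> y \<longrightarrow> rank_le (e 0) y)" by (intro dfn)
    then show "D (\<lambda>e. \<forall>y. y \<in> U \<longrightarrow> e 0 \<sqin> y \<longrightarrow> rank_le (e 0) y)" by (simp add: Ball_def)
    fix x assume "x \<in> U" "\<And>u. u \<sqin> x \<Longrightarrow> \<forall>y. y \<in> U \<longrightarrow> u \<sqin> y \<longrightarrow> rank_le u y"
    then show "\<forall>y. y \<in> U \<longrightarrow> x \<sqin> y \<longrightarrow> rank_le x y"
      using rank_le_iff by blast
  qed (use xy mem_U in blast)
  then show ?thesis using xy mem_U by blast
qed

lemma small_subsets: "T \<in> U \<Longrightarrow> small (\<lambda>s. \<forall>z. z \<sqin> s \<longrightarrow> z \<sqin> T)"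
  unfolding small_def by (rule power)

text \<open>Levels of the cumulative hierarchy are sets: if \<open>T\<close> bounds the levels
  belonging to members of \<open>y\<close>, then any \<open>x\<close> with
  \<open>rank_le x y\<close> is a subset of \<open>T\<close>, and the power set axiom
  applies.\<close>

lemma small_rank_le:
  assumes "y \<in> U"
  shows "small (\<lambda>x. rank_le x y)"
proof (rule mem_induct[where Q = "\<lambda>y. small (\<lambda>x. rank_le x y)", OF _ _ assms])
  show "D (\<lambda>e. small (\<lambda>x. rank_le x (e 0)))" unfolding small_def by (intro dfn)
  fix y assume y: "y \<in> U" and IH: "\<And>v. v \<sqin> y \<Longrightarrow> small (\<lambda>x. rank_le x v)"
  have "small (\<lambda>x. \<exists>v. v \<sqin> y \<and> rank_le x v)"
    by (rule small_UN[OF y _ IH]) (intro dfn)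
  then obtain T where T: "T \<in> U" "\<And>x v. x \<in> U \<Longrightarrow> v \<sqin> y \<Longrightarrow> rank_le x v \<Longrightarrow> x \<sqin> T"
    unfolding small_def by blast
  show "small (\<lambda>x. rank_le x y)"
  proof (rule small_subclass[OF small_subsets[OF T(1)]], intro allI impI)
    fix x z assume "x \<in> U" "rank_le x y" "z \<sqin> x"
    then show "z \<sqin> T" using T(2) rank_le_iff[OF _ y] mem_U by blast
  qed
qed

text \<open>Burali-Forti: the set of all ordinals would be an ordinal and so its own member.\<close>

lemma ordinal_not_small: "\<not> small ordinal"
proof
  assume "small ordinal"
  then obtain s where s: "s \<in> U" "\<And>x. x \<sqin> s \<longleftrightarrow> x \<in> U \<and> ordinal x"
    by (rule small_set) (auto intro!: dfn)
  have "ordinal s"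
    by (rule ordinalI) (use s ordinal_mem mem_U in blast)+
  then show False using s no_cycle1 by blast
qed

text \<open>Otherwise, by totality, all ordinals would have rank at most that of \<open>a\<close>
  and so be bounded by a set.\<close>

lemma ordinal_above:
  assumes "a \<in> U"
  shows "\<exists>x \<in> U. ordinal x \<and> rank_le a x"
proof (rule ccontr)
  assume "\<not> ?thesis"
  then have "small ordinal"
    using small_subclass[OF small_rank_le[OF assms]] rank_le_total assms by blast
  then show False using ordinal_not_small by blast
qed

text \<open>The witness is the supremum of the successors of the ordinals in
  \<open>b\<close>.\<close>

lemma ordinal_strict_bound:
  assumes b: "b \<in> U"
  shows "\<exists>s \<in> U. ordinal s \<and> (\<forall>v. v \<sqin> b \<longrightarrow> ordinal v \<longrightarrow> v \<sqin> s)"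
proof -
  have "small (\<lambda>w. w \<sqin> b \<or> (\<exists>v. v \<sqin> b \<and> w \<sqin> v))"
    by (intro small_disj small_UN small_mem b dfn) (use mem_U in blast)
  then have "small (\<lambda>w. (w \<sqin> b \<and> ordinal w) \<or> (\<exists>v. v \<sqin> b \<and> ordinal v \<and> w \<sqin> v))"
    by (rule small_subclass) blast
  moreover have "D (\<lambda>e. (e 0 \<sqin> b \<and> ordinal (e 0)) \<or> (\<exists>v. v \<sqin> b \<and> ordinal v \<and> e 0 \<sqin> v))"
    by (intro dfn b)
  ultimately obtain s where s: "s \<in> U"
    "\<And>w. w \<sqin> s \<longleftrightarrow> w \<in> U \<and> ((w \<sqin> b \<and> ordinal w) \<or> (\<exists>v. v \<sqin> b \<and> ordinal v \<and> w \<sqin> v))"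
    by (rule small_set) blast
  have "ordinal s"
  proof (rule ordinalI)
    show "z \<sqin> s" if "z \<sqin> y" "y \<sqin> s" for y z
      using that mem_U ordinal_trans unfolding s(2) by blast
    show "ordinal y" if "y \<sqin> s" for y
      using that ordinal_mem unfolding s(2) by blast
  qed
  then show ?thesis using s mem_U by blast
qed

end

section \<open>Definable mutual interpretations of set-theoretic worlds\<close>

text \<open>
  \<open>(U', E)\<close> is a model interpreted in the outer model \<open>(U, \<sqin>)\<close>, and \<open>(Ms, Es)\<close> a copy of the outer
  model interpreted in the inner one; \<open>D\<close> and \<open>D'\<close> are the predicates definable with parameters in
  the outer and the inner structure, which may carry further relations.
\<close>

locale mutual_interpretation =
  M: zf_world U mem D + N: zf_world U' E D'
  for U :: "'a set" and mem (infix "\<sqin>" 50) and D and U' :: "'a set" and E and D' +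
  fixes Ms :: "'a set" and Es :: "'a \<Rightarrow> 'a \<Rightarrow> bool" and F :: "'a \<Rightarrow> 'a" and G :: "'a \<Rightarrow> 'a \<Rightarrow> bool"
  assumes U'_sub: "U' \<subseteq> U"
    and transfer1: "D' (\<lambda>e. Q (e 0)) \<Longrightarrow> D (\<lambda>e. e 0 \<in> U' \<and> Q (e 0))"
    and transfer2: "D' (\<lambda>e. R (e 0) (e 1)) \<Longrightarrow> D (\<lambda>e. e 0 \<in> U' \<and> e 1 \<in> U' \<and> R (e 0) (e 1))"
    and D_U': "D (\<lambda>e. e 0 \<in> U')"
    and Ms_sub: "Ms \<subseteq> U'" and D'_Ms: "D' (\<lambda>e. e 0 \<in> Ms)"
    and Es_Ms: "Es x y \<Longrightarrow> x \<in> Ms \<and> y \<in> Ms" and D'_Es: "D' (\<lambda>e. Es (e 0) (e 1))"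
    and F_bij: "bij_betw F U Ms" and D_F: "D (\<lambda>e. F (e 0) = e 1)"
    and F_mem: "x \<in> U \<Longrightarrow> y \<in> U \<Longrightarrow> Es (F x) (F y) \<longleftrightarrow> x \<sqin> y"
    and D'_G: "D' (\<lambda>e. G (e 0) (e 1))" and G_ex: "x \<in> U' \<Longrightarrow> \<exists>y \<in> Ms. G x y"
    and G_inj: "x \<in> U' \<Longrightarrow> x' \<in> U' \<Longrightarrow> G x y \<Longrightarrow> G x' y \<Longrightarrow> x = x'"
begin

section \<open>The copy \<open>Ms\<close> and its set-sized bisimulations with the inner
  model\<close>

lemmas [dfn] = M.D_subst1[OF D_U'] N.D_subst1[OF D'_Ms] N.D_subst2[OF D'_Es]
  N.D_subst2[OF D'_G] M.D_subst2[OF D_F]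

lemma D_ball_U' [dfn]:
  assumes "D (\<lambda>e. Q (e 0) (\<lambda>i. e (Suc i)))"
  shows "D (\<lambda>e. \<forall>x \<in> U'. Q x e)"
proof -
  have "D (\<lambda>e. \<forall>x \<in> U. x \<in> U' \<longrightarrow> Q x e)" by (intro dfn assms)
  then show ?thesis by (rule M.D_cong) (use U'_sub in blast)
qed

lemma D_bex_U' [dfn]:
  assumes "D (\<lambda>e. Q (e 0) (\<lambda>i. e (Suc i)))"
  shows "D (\<lambda>e. \<exists>x \<in> U'. Q x e)"
proof -
  have "D (\<lambda>e. \<exists>x \<in> U. x \<in> U' \<and> Q x e)" by (intro dfn assms)
  then show ?thesis by (rule M.D_cong) (use U'_sub in blast)
qed

lemma F_U: "x \<in> U \<Longrightarrow> F x \<in> Ms"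
  using F_bij by (auto simp: bij_betw_def)

lemma F_surj: "z \<in> Ms \<Longrightarrow> \<exists>x \<in> U. F x = z"
  using F_bij by (auto simp: bij_betw_def)

lemma F_inj: "F x = F y \<Longrightarrow> x \<in> U \<Longrightarrow> y \<in> U \<Longrightarrow> x = y"
  using F_bij by (auto simp: bij_betw_def inj_on_def)

lemma Es_F: "x \<in> U \<Longrightarrow> Es z (F x) \<longleftrightarrow> (\<exists>y. y \<sqin> x \<and> z = F y)"
  using F_surj Es_Ms F_mem M.mem_U by blast

lemma Ms_ext:
  assumes "y \<in> Ms" "z \<in> Ms" "\<And>w. Es w y \<longleftrightarrow> Es w z"
  shows "y = z"
proof -
  obtain a b where ab: "a \<in> U" "b \<in> U" "y = F a" "z = F b" using F_surj assms by metis
  have "x \<sqin> a \<longleftrightarrow> x \<sqin> b" for x using assms(3)[of "F x"] F_mem ab M.mem_U by metis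
  then show ?thesis using M.ext ab by blast
qed

text \<open>Well-foundedness is borrowed from the outer model: a \<open>D'\<close>-definable
  predicate becomes \<open>D\<close>-definable by \<open>transfer1\<close>, so
  \<open>M.mem_induct\<close> applies to it along \<open>F\<close>.\<close>

lemma Ms_induct:
  assumes D: "D' (\<lambda>e. Q (e 0))" and step: "\<And>y. y \<in> Ms \<Longrightarrow> (\<And>z. Es z y \<Longrightarrow> Q z) \<Longrightarrow> Q y"
    and y: "y \<in> Ms"
  shows "Q y"
proof -
  obtain x where x: "x \<in> U" "y = F x" using F_surj y by blast
  have "\<exists>z \<in> U. F x = z \<and> z \<in> U' \<and> Q z" (is "?Q x")
  proof (rule M.mem_induct[where Q = ?Q, OF _ _ x(1)])
    show "D (\<lambda>e. ?Q (e 0))"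
      by (intro dfn M.D_subst1[OF transfer1[OF D]])
    fix x assume x: "x \<in> U" "\<And>u. u \<sqin> x \<Longrightarrow> ?Q u"
    have "Q z" if "Es z (F x)" for z using that x(2) unfolding Es_F[OF x(1)] by blast
    then have "Q (F x)" by (rule step[OF F_U[OF x(1)]])
    then show "?Q x" using x F_U Ms_sub U'_sub by blast
  qed
  then show ?thesis using x by blast
qed

text \<open>One bisimulation step between \<open>E\<close> below \<open>u\<close> and
  \<open>Es\<close> below \<open>v\<close>. Elements outside \<open>Ms\<close> have no
  \<open>Es\<close>-members, so the clause \<open>v \<in> Ms\<close> keeps them from being matched
  with the empty set.\<close>

definition sim_op :: "'a \<Rightarrow> 'a \<Rightarrow> ('a \<Rightarrow> 'a \<Rightarrow> bool) \<Rightarrow> bool" where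
  "sim_op u v X \<longleftrightarrow> v \<in> Ms \<and> (\<forall>x. E x u \<longrightarrow> (\<exists>y \<in> U'. Es y v \<and> X x y)) \<and>
     (\<forall>y \<in> U'. Es y v \<longrightarrow> (\<exists>x. E x u \<and> X x y))"

definition sim :: "'a \<Rightarrow> 'a \<Rightarrow> bool" where
  "sim = N.corec_rel sim_op"

lemma D'_closed_sim: "D' (\<lambda>e. N.closed_under sim_op (e 0))"
  unfolding N.closed_under_def sim_op_def by (intro dfn)

lemma D'_sim [dfn]: "trm U' s \<Longrightarrow> trm U' t \<Longrightarrow> D' (\<lambda>e. sim (s e) (t e))"
  unfolding sim_def by (rule N.D_corec_rel[OF D'_closed_sim])

lemma mono_sim: "N.mono_op sim_op"
  unfolding N.mono_op_def sim_op_def using N.mem_U by (intro allI impI ballI) blast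

lemma sim_unfold: "sim u v \<Longrightarrow> u \<in> U' \<Longrightarrow> v \<in> U' \<Longrightarrow> sim_op u v sim"
  unfolding sim_def by (rule N.corec_rel_unfold[OF mono_sim])

lemma sim_Ms: "sim u v \<Longrightarrow> u \<in> U' \<Longrightarrow> v \<in> U' \<Longrightarrow> v \<in> Ms"
  using sim_unfold unfolding sim_op_def by blast

lemma sim_forward: "sim u v \<Longrightarrow> v \<in> U' \<Longrightarrow> E x u \<Longrightarrow> \<exists>y. Es y v \<and> sim x y"
  using sim_unfold N.mem_U unfolding sim_op_def by blast

lemma sim_backward: "sim u v \<Longrightarrow> u \<in> U' \<Longrightarrow> Es y v \<Longrightarrow> \<exists>x. E x u \<and> sim x y"
  using sim_unfold Es_Ms Ms_sub unfolding sim_op_def by blast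

text \<open>Induction along \<open>E\<close>: members of \<open>v\<close> and \<open>v'\<close> are
  identified through common partners in \<open>u\<close>, and \<open>Ms_ext\<close>
  concludes.\<close>

lemma sim_right_unique:
  assumes "u \<in> U'" "v \<in> U'" "v' \<in> U'" "sim u v" "sim u v'"
  shows "v = v'"
proof -
  have "\<forall>v \<in> U'. \<forall>v' \<in> U'. sim u v \<longrightarrow> sim u v' \<longrightarrow> v = v'" (is "?Q u")
  proof (rule N.mem_induct[where Q = ?Q, OF _ _ assms(1)])
    show "D' (\<lambda>e. ?Q (e 0))" by (intro dfn)
    fix u assume u: "u \<in> U'" and IH: "\<And>x. E x u \<Longrightarrow> ?Q x"
    have sub: "Es w v'" if v: "v \<in> U'" "v' \<in> U'" "sim u v" "sim u v'" and w: "Es w v" for v v' w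
    proof -
      obtain x where x: "E x u" "sim x w" using sim_backward v u w by blast
      obtain w' where w': "Es w' v'" "sim x w'" using sim_forward v x by blast
      have "w = w'" using IH[OF x(1)] x w' w Es_Ms Ms_sub by blast
      then show ?thesis using w' by simp
    qed
    show "?Q u"
      by (intro ballI impI, rule Ms_ext) (use sub sim_Ms u in blast)+
  qed
  then show ?thesis using assms by blast
qed

text \<open>Again induction along \<open>E\<close>, now through common partners in \<open>v\<close>
  and with extensionality of the inner model.\<close>

lemma sim_left_unique:
  assumes "u \<in> U'" "u' \<in> U'" "v \<in> U'" "sim u v" "sim u' v"
  shows "u = u'"
proof -
  have "\<forall>u' \<in> U'. \<forall>v \<in> U'. sim u v \<longrightarrow> sim u' v \<longrightarrow> u = u'" (is "?Q u")
  proof (rule N.mem_induct[where Q = ?Q, OF _ _ assms(1)])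
    show "D' (\<lambda>e. ?Q (e 0))" by (intro dfn)
    fix u assume u: "u \<in> U'" and IH: "\<And>x. E x u \<Longrightarrow> ?Q x"
    show "?Q u"
    proof (intro ballI impI, rule N.ext)
      fix u' v w assume v: "u' \<in> U'" "v \<in> U'" "sim u v" "sim u' v"
      show "E w u \<longleftrightarrow> E w u'"
      proof
        assume w: "E w u"
        obtain y where y: "Es y v" "sim w y" using sim_forward v w by blast
        obtain x where x: "E x u'" "sim x y" using sim_backward v y by blast
        have "w = x" using IH[OF w] x y Es_Ms Ms_sub N.mem_U by blast
        then show "E w u'" using x by simp
      next
        assume w: "E w u'"
        obtain y where y: "Es y v" "sim w y" using sim_forward v w by blast
        obtain x where x: "E x u" "sim x y" using sim_backward v u y by blast
        have "x = w" using IH[OF x(1)] w x y Es_Ms Ms_sub N.mem_U by blast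
        then show "E w u" using x by simp
      qed
    qed (use u in auto)
  qed
  then show ?thesis using assms by blast
qed

text \<open>Collection turns the forward matching into a set \<open>w\<close> of pairs. This
  \<open>w\<close> also serves the backward clause, since \<open>sim_right_unique\<close> forces the
  partner found in \<open>w\<close> to be the given \<open>y\<close>.\<close>

lemma sim_fold:
  assumes u: "u \<in> U'" and v: "v \<in> Ms"
    and forward: "\<And>x. E x u \<Longrightarrow> \<exists>y. Es y v \<and> sim x y"
    and backward: "\<And>y. Es y v \<Longrightarrow> \<exists>x. E x u \<and> sim x y"
  shows "sim u v"
proof -
  have v': "v \<in> U'" using v Ms_sub by blast
  have D: "D' (\<lambda>e. Es (e 1) v \<and> sim (e 0) (e 1))" by (intro dfn v')
  have ex: "\<exists>y \<in> U'. Es y v \<and> sim x y" if "E x u" for x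
    using forward that Es_Ms Ms_sub by blast
  obtain w where w: "w \<in> U'"
    "\<And>x y. x \<in> U' \<Longrightarrow> y \<in> U' \<Longrightarrow> N.related w x y \<Longrightarrow> E x u \<and> Es y v \<and> sim x y"
    "\<And>x. E x u \<Longrightarrow> \<exists>y \<in> U'. N.related w x y"
    using N.related_set[OF D u ex] by blast
  have "sim_op u v (N.related w)" unfolding sim_op_def
  proof (intro conjI allI ballI impI v)
    fix x assume "E x u"
    then show "\<exists>y \<in> U'. Es y v \<and> N.related w x y" using w N.mem_U by blast
  next
    fix y assume y: "y \<in> U'" "Es y v"
    obtain x where x: "E x u" "sim x y" using backward y by blast
    obtain z where z: "z \<in> U'" "N.related w x z" using w(3) x by blast
    have "z = y" using sim_right_unique[of x] w(2)[of x z] x y z N.mem_U by blast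
    then show "\<exists>x. E x u \<and> N.related w x y" using x z by blast
  qed
  then show ?thesis unfolding sim_def
    by (rule N.corec_rel_fold[OF mono_sim D'_closed_sim u v' w(1)])
      (use w(2) in \<open>simp add: sim_def\<close>)
qed

section \<open>Rank bounds on the matched part of the inner model\<close>

abbreviation le :: "'a \<Rightarrow> 'a \<Rightarrow> bool" where
  "le \<equiv> N.rank_le"

lemma D_le: "D (\<lambda>e. e 0 \<in> U' \<and> e 1 \<in> U' \<and> le (e 0) (e 1))"
  by (rule transfer2) (intro dfn)

lemma D_sim: "D (\<lambda>e. e 0 \<in> U' \<and> e 1 \<in> U' \<and> sim (e 0) (e 1))"
  by (rule transfer2) (intro dfn)

lemma D_E: "D (\<lambda>e. e 0 \<in> U' \<and> e 1 \<in> U' \<and> E (e 0) (e 1))"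
  by (rule transfer2) (intro dfn)

lemma D_E' [dfn]: "trm U s \<Longrightarrow> trm U t \<Longrightarrow> D (\<lambda>e. E (s e) (t e))"
  by (rule M.D_subst2[of E]) (use N.mem_U in \<open>auto intro!: M.D_cong[OF D_E]\<close>)

text \<open>In the inner sense of rank, \<open>w\<close> lies at or below a partner of
  \<open>F x\<close>. These segments of the inner model are what the outer model can bound by
  induction on \<open>x\<close>.\<close>

definition le_image :: "'a \<Rightarrow> 'a \<Rightarrow> bool" where
  "le_image w x \<longleftrightarrow> (\<exists>y \<in> U'. w \<in> U' \<and> sim y (F x) \<and> le w y)"

lemma D_simF: "D (\<lambda>e. e 0 \<in> U' \<and> sim (e 0) (F (e 1)))"
proof -
  have "D (\<lambda>e. e 0 \<in> U' \<and> (\<exists>z \<in> U. F (e 1) = z \<and> (e 0 \<in> U' \<and> z \<in> U' \<and> sim (e 0) z)))"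
    by (intro dfn M.D_subst2[OF D_sim])
  then show ?thesis
    by (rule M.D_cong) (use F_U Ms_sub U'_sub in blast)
qed

lemma D_le_image [dfn]: "trm U s \<Longrightarrow> trm U t \<Longrightarrow> D (\<lambda>e. le_image (s e) (t e))"
proof (rule M.D_subst2)
  have "D (\<lambda>e. \<exists>y \<in> U. (y \<in> U' \<and> sim y (F (e 1))) \<and> (e 0 \<in> U' \<and> y \<in> U' \<and> le (e 0) y))"
    by (intro dfn M.D_subst2[OF D_simF] M.D_subst2[OF D_le])
  then show "D (\<lambda>e. le_image (e 0) (e 1))"
    by (rule M.D_cong) (use U'_sub in \<open>auto simp: le_image_def\<close>)
qed

text \<open>An inner set is determined by its \<open>E\<close>-extension, here a subset of
  \<open>T\<close> in the outer model; the outer power set bounds these subsets, and collection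
  bounds the inner sets they determine.\<close>

lemma small_extension_subset:
  assumes T: "T \<in> U"
  shows "M.small (\<lambda>w. w \<in> U' \<and> (\<forall>z. E z w \<longrightarrow> z \<sqin> T))"
proof -
  obtain p where p: "p \<in> U" "\<And>y. y \<in> U \<Longrightarrow> (\<And>z. z \<sqin> y \<Longrightarrow> z \<sqin> T) \<Longrightarrow> y \<sqin> p"
    using M.power[OF T] by blast
  have "M.small (\<lambda>w. \<exists>s. s \<sqin> p \<and> (w \<in> U' \<and> (\<forall>z \<in> U. E z w \<longleftrightarrow> z \<sqin> s)))"
  proof (rule M.small_UN[OF p(1)])
    show "D (\<lambda>e. e 1 \<in> U' \<and> (\<forall>z \<in> U. E z (e 1) \<longleftrightarrow> z \<sqin> e 0))" by (intro dfn)
    show "M.small (\<lambda>w. w \<in> U' \<and> (\<forall>z \<in> U. E z w \<longleftrightarrow> z \<sqin> s))" for s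
      by (rule M.small_at_most_one, rule N.ext) (use N.mem_U U'_sub in blast)+
  qed
  then show ?thesis
  proof (rule M.small_subclass)
    fix w assume w: "w \<in> U" "w \<in> U' \<and> (\<forall>z. E z w \<longrightarrow> z \<sqin> T)"
    have "D (\<lambda>e. E (e 0) w)" by (intro dfn w)
    from M.separation[OF this T] obtain s where "s \<in> U" "\<And>x. x \<sqin> s \<longleftrightarrow> x \<sqin> T \<and> E x w" by blast
    with w p show "\<exists>s. s \<sqin> p \<and> (w \<in> U' \<and> (\<forall>z \<in> U. E z w \<longleftrightarrow> z \<sqin> s))" by blast
  qed
qed

text \<open>A member of \<open>w\<close> is dominated by a member of the partner \<open>y\<close> of
  \<open>F x\<close>, and \<open>sim\<close> matches the latter with \<open>F x'\<close> for some
  \<open>x'\<close> in \<open>x\<close>.\<close>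

lemma le_image_step:
  assumes x: "x \<in> U" and w: "le_image w x" and u: "E u w"
  shows "\<exists>x'. x' \<sqin> x \<and> le_image u x'"
proof -
  obtain y where y: "y \<in> U'" "w \<in> U'" "sim y (F x)" "le w y" using w unfolding le_image_def by blast
  obtain v where v: "E v y" "le u v" using y u N.rank_le_iff[of w y] by blast
  obtain z where z: "Es z (F x)" "sim v z" using sim_forward y v F_U x Ms_sub by blast
  then obtain x' where "x' \<sqin> x" "z = F x'" using Es_F x by blast
  then show ?thesis using v z u N.mem_U unfolding le_image_def by blast
qed

text \<open>Induction on \<open>x\<close> as in \<open>small_rank_le\<close>: by
  \<open>le_image_step\<close> the extension of \<open>w\<close> lies in a set bounding the segments
  of the members of \<open>x\<close>, so \<open>small_extension_subset\<close> applies.\<close>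

lemma small_le_image:
  assumes "x \<in> U"
  shows "M.small (\<lambda>w. le_image w x)"
proof (rule M.mem_induct[where Q = "\<lambda>x. M.small (\<lambda>w. le_image w x)", OF _ _ assms])
  show "D (\<lambda>e. M.small (\<lambda>w. le_image w (e 0)))" unfolding M.small_def by (intro dfn)
  fix x assume x: "x \<in> U" and IH: "\<And>u. u \<sqin> x \<Longrightarrow> M.small (\<lambda>w. le_image w u)"
  have "M.small (\<lambda>w. \<exists>u. u \<sqin> x \<and> le_image w u)"
    by (rule M.small_UN[OF x _ IH]) (intro dfn)
  then obtain T where T: "T \<in> U" "\<And>w u. w \<in> U \<Longrightarrow> u \<sqin> x \<Longrightarrow> le_image w u \<Longrightarrow> w \<sqin> T"
    unfolding M.small_def by blast
  show "M.small (\<lambda>w. le_image w x)"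
  proof (rule M.small_subclass[OF small_extension_subset[OF T(1)]], intro conjI allI impI)
    fix w assume w: "w \<in> U" "le_image w x"
    then show "w \<in> U'" unfolding le_image_def by blast
    fix z assume z: "E z w"
    then show "z \<sqin> T" using le_image_step[OF x w(2) z] T(2) N.mem_U U'_sub by blast
  qed
qed

text \<open>Otherwise \<open>F\<close> would inject the outer universe into a set.\<close>

lemma not_small_U': "\<not> M.small (\<lambda>w. w \<in> U')"
proof
  assume "M.small (\<lambda>w. w \<in> U')"
  then obtain b where b: "b \<in> U" "\<And>w. w \<in> U' \<Longrightarrow> w \<sqin> b"
    unfolding M.small_def using U'_sub by blast
  have "M.small (\<lambda>x. \<exists>w. w \<sqin> b \<and> F x = w)"
    by (rule M.small_UN[OF b(1)]) (auto intro!: dfn M.small_at_most_one dest: F_inj)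
  then have "M.small (\<lambda>x. True)"
    by (rule M.small_subclass) (use b F_U Ms_sub in blast)
  then show False using M.not_small_U by blast
qed

text \<open>By \<open>Es\<close>-induction the members of \<open>z\<close> have partners. The only
  obstacle to collecting these into an inner set is that they might form a proper class of the inner
  model, which the outer model rules out.\<close>

lemma sim_range:
  assumes "z \<in> Ms"
  shows "\<exists>y \<in> U'. sim y z"
proof (rule Ms_induct[where Q = "\<lambda>z. \<exists>y \<in> U'. sim y z", OF _ _ assms])
  show "D' (\<lambda>e. \<exists>y \<in> U'. sim y (e 0))" by (intro dfn)
  fix z assume z: "z \<in> Ms" and IH: "\<And>z'. Es z' z \<Longrightarrow> \<exists>y \<in> U'. sim y z'"
  have z': "z \<in> U'" using z Ms_sub by blast
  obtain x where x: "x \<in> U" "z = F x" using F_surj z by blast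
  define X where "X y \<longleftrightarrow> (\<exists>z' \<in> U'. Es z' z \<and> sim y z')" for y
  \<comment> \<open>Partners unbounded in rank would put every \<open>w\<close> of \<open>U'\<close>
    below one of them, so \<open>small_le_image\<close> for the members of \<open>x\<close> would
    make \<open>U'\<close> small in the outer model.\<close>
  have X: "N.small X"
  proof (rule ccontr)
    assume unbounded: "\<not> N.small X"
    have "M.small (\<lambda>w. \<exists>x'. x' \<sqin> x \<and> le_image w x')"
      by (rule M.small_UN[OF x(1)]) (auto intro!: dfn small_le_image dest: M.mem_U)
    moreover have "\<exists>x'. x' \<sqin> x \<and> le_image w x'" if w: "w \<in> U'" for w
    proof -
      have "\<not> (\<forall>y \<in> U'. X y \<longrightarrow> le y w)"
        using unbounded N.small_subclass[OF N.small_rank_le[OF w]] by blast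
      then obtain y z' where y: "y \<in> U'" "le w y" "z' \<in> U'" "Es z' z" "sim y z'"
        using N.rank_le_total w unfolding X_def by blast
      then obtain x' where "x' \<sqin> x" "z' = F x'" using Es_F[OF x(1), of z'] x(2) by blast
      then show ?thesis using y w unfolding le_image_def by blast
    qed
    ultimately have "M.small (\<lambda>w. w \<in> U')" by (rule M.small_subclass)
    then show False using not_small_U' by blast
  qed
  have "D' (\<lambda>e. X (e 0))" unfolding X_def by (intro dfn z')
  with X obtain y where y: "y \<in> U'" "\<And>x. E x y \<longleftrightarrow> x \<in> U' \<and> X x" by (rule N.small_set) blast
  have "sim y z"
  proof (rule sim_fold[OF y(1) z])
    show "E x y \<Longrightarrow> \<exists>v. Es v z \<and> sim x v" for x unfolding y(2) X_def by blast
    show "Es v z \<Longrightarrow> \<exists>x. E x y \<and> sim x v" for v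
      using IH[of v] Es_Ms Ms_sub unfolding y(2) X_def by blast
  qed
  then show "\<exists>y \<in> U'. sim y z" using y by blast
qed

text \<open>Otherwise all partners would have rank at most that of \<open>w\<close> and lie in an
  inner set \<open>b\<close>. The image of \<open>b\<close> under the single-valued
  \<open>sim\<close> would be bounded by a set \<open>c\<close> containing \<open>Ms\<close>, and
  \<open>G\<close> would inject the inner universe into \<open>c\<close>.\<close>

lemma le_image_unbounded:
  assumes w: "w \<in> U'"
  shows "\<exists>x \<in> U. le_image w x"
proof (rule ccontr)
  assume no: "\<not> ?thesis"
  obtain b where b: "b \<in> U'" "\<And>y. y \<in> U' \<Longrightarrow> le y w \<Longrightarrow> E y b"
    using N.small_rank_le[OF w] unfolding N.small_def by blast
  have "N.small (\<lambda>z. \<exists>y. E y b \<and> sim y z)"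
    by (rule N.small_UN[OF b(1)])
      (auto intro!: dfn N.small_at_most_one dest: sim_right_unique N.mem_U)
  then obtain c where c: "c \<in> U'" "\<And>y z. z \<in> U' \<Longrightarrow> E y b \<Longrightarrow> sim y z \<Longrightarrow> E z c"
    unfolding N.small_def by blast
  have Ms_c: "E z c" if z: "z \<in> Ms" for z
  proof -
    obtain x where x: "x \<in> U" "z = F x" using F_surj z by blast
    obtain y where y: "y \<in> U'" "sim y z" using sim_range z by blast
    then have "\<not> le w y" using no x w unfolding le_image_def by blast
    then have "le y w" using N.rank_le_total y w by blast
    then show ?thesis using b c y z Ms_sub by blast
  qed
  have "N.small (\<lambda>x. \<exists>z. E z c \<and> G x z)"
    by (rule N.small_UN[OF c(1)]) (auto intro!: dfn N.small_at_most_one dest: G_inj)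
  then have "N.small (\<lambda>x. True)"
    by (rule N.small_subclass) (use G_ex Ms_c in blast)
  then show False using N.not_small_U by blast
qed

section \<open>The definable isomorphism from the outer onto the inner model\<close>

definition h :: "'a \<Rightarrow> 'a" where
  "h x = (THE y. y \<in> U' \<and> sim y (F x))"

lemma h_eq: "x \<in> U \<Longrightarrow> h x = y \<longleftrightarrow> y \<in> U' \<and> sim y (F x)"
proof -
  assume x: "x \<in> U"
  have F: "F x \<in> Ms" "F x \<in> U'" using F_U x Ms_sub by blast+
  have "\<exists>!y. y \<in> U' \<and> sim y (F x)"
    using sim_range[OF F(1)] sim_left_unique F by blast
  from theI'[OF this] this show ?thesis unfolding h_def by blast
qed

lemma h_U': "x \<in> U \<Longrightarrow> h x \<in> U'"
  using h_eq by blast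

lemma E_h: "x \<in> U \<Longrightarrow> E w (h x) \<longleftrightarrow> (\<exists>y. y \<sqin> x \<and> w = h y)"
proof -
  assume x: "x \<in> U"
  have hx: "h x \<in> U'" "sim (h x) (F x)" using h_eq x by blast+
  have F: "F x \<in> U'" using F_U x Ms_sub by blast
  show ?thesis
  proof
    assume w: "E w (h x)"
    obtain z where z: "Es z (F x)" "sim w z" using sim_forward[OF hx(2) F w] by blast
    then obtain y where y: "y \<sqin> x" "z = F y" using Es_F[OF x, of z] by blast
    have "h y = w" using h_eq[of y w] y z w M.mem_U N.mem_U by blast
    then show "\<exists>y. y \<sqin> x \<and> w = h y" using y by blast
  next
    assume "\<exists>y. y \<sqin> x \<and> w = h y"
    then obtain y where y: "y \<sqin> x" "w = h y" by blast
    then have "Es (F y) (F x)" using Es_F[OF x, of "F y"] by blast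
    then obtain v where v: "E v (h x)" "sim v (F y)" using sim_backward[OF hx(2,1)] by blast
    then have "h y = v" using h_eq[of y v] y M.mem_U N.mem_U by blast
    then show "E w (h x)" using v y by simp
  qed
qed

lemma h_inj: "inj_on h U"
proof (rule inj_onI)
  fix x y assume xy: "x \<in> U" "y \<in> U" "h x = h y"
  have "sim (h x) (F x)" "sim (h x) (F y)" using h_eq xy by metis+
  then have "F x = F y" using sim_right_unique[of "h x"] h_U' F_U Ms_sub xy by blast
  then show "x = y" using F_inj xy by blast
qed

lemma h_mem: "x \<in> U \<Longrightarrow> y \<in> U \<Longrightarrow> E (h x) (h y) \<longleftrightarrow> x \<sqin> y"
  using E_h h_inj M.mem_U unfolding inj_on_def by metis

lemma D_h: "D (\<lambda>e. h (e 0) = e 1)"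
proof -
  have "D (\<lambda>e. e 1 \<in> U' \<and> sim (e 1) (F (e 0)))"
    by (rule M.D_subst2[OF D_simF]) (intro dfn)+
  then show ?thesis by (rule M.D_cong) (use h_eq in auto)
qed

text \<open>Unboundedness gives \<open>x\<close> with \<open>le_image y x\<close>, and induction on
  \<open>x\<close> shows that every such \<open>y\<close> is a value. The members of
  \<open>y\<close> are values by hypothesis, their preimages form an outer set \<open>v\<close>, and
  \<open>h v\<close> has the same extension as \<open>y\<close>.\<close>

lemma h_surj:
  assumes y: "y \<in> U'"
  shows "\<exists>x \<in> U. h x = y"
proof -
  note [dfn] = M.D_subst2[OF D_h]
  obtain x where x: "x \<in> U" "le_image y x" using le_image_unbounded y by blast
  have "\<forall>y \<in> U'. le_image y x \<longrightarrow> (\<exists>x \<in> U. h x = y)" (is "?Q x")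
  proof (rule M.mem_induct[where Q = ?Q, OF _ _ x(1)])
    show "D (\<lambda>e. ?Q (e 0))" by (intro dfn)
    fix x assume x: "x \<in> U" and IH: "\<And>u. u \<sqin> x \<Longrightarrow> ?Q u"
    show "?Q x"
    proof (intro ballI impI)
      fix y assume y: "y \<in> U'" "le_image y x"
      have yU: "y \<in> U" using y U'_sub by blast
      have mem: "\<exists>u. u \<sqin> x \<and> le_image w u" if "E w y" for w
        using le_image_step x y that by blast
      have "M.small (\<lambda>w. \<exists>u. u \<sqin> x \<and> le_image w u)"
        by (rule M.small_UN[OF x]) (auto intro!: dfn small_le_image dest: M.mem_U)
      then obtain b where b: "b \<in> U" "\<And>w. E w y \<Longrightarrow> w \<sqin> b"
        unfolding M.small_def using mem N.mem_U U'_sub by blast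
      have "M.small (\<lambda>v. \<exists>w. w \<sqin> b \<and> h v = w)"
        by (rule M.small_UN[OF b(1)])
          (auto intro!: dfn M.small_at_most_one dest: inj_onD[OF h_inj])
      then have "M.small (\<lambda>v. \<exists>w \<in> U. h v = w \<and> E w y)"
        by (rule M.small_subclass) (use b in blast)
      moreover have "D (\<lambda>e. \<exists>w \<in> U. h (e 0) = w \<and> E w y)"
        by (intro dfn yU)
      ultimately obtain v where v: "v \<in> U" "\<And>a. a \<sqin> v \<longleftrightarrow> a \<in> U \<and> (\<exists>w \<in> U. h a = w \<and> E w y)"
        by (rule M.small_set) blast
      have "h v = y"
      proof (rule N.ext)
        fix w
        show "E w (h v) \<longleftrightarrow> E w y"
        proof
          assume w: "E w y"
          then obtain a where "a \<in> U" "h a = w" using mem IH N.mem_U by blast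
          then show "E w (h v)" unfolding E_h[OF v(1)] v(2) using w N.mem_U U'_sub by blast
        qed (auto simp: E_h[OF v(1)] v(2))
      qed (use h_U' v y in blast)+
      then show "\<exists>x \<in> U. h x = y" using v by blast
    qed
  qed
  then show ?thesis using x y by blast
qed

theorem definable_isomorphism:
  "bij_betw h U U'" "D (\<lambda>e. h (e 0) = e 1)" "x \<in> U \<Longrightarrow> y \<in> U \<Longrightarrow> E (h x) (h y) \<longleftrightarrow> x \<sqin> y"
  using h_inj h_surj h_U' D_h h_mem by (auto simp: bij_betw_def)

end

section \<open>Definability in first-order structures\<close>

text \<open>Restricting to the universe secures \<open>mem_U\<close>.\<close>

definition memrel :: "('r, 'a) fo_struct \<Rightarrow> 'r \<Rightarrow> 'a \<Rightarrow> 'a \<Rightarrow> bool" where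
  "memrel S E x y \<longleftrightarrow> x \<in> univ S \<and> y \<in> univ S \<and> rel S E [x, y]"

text \<open>Every variable of \<open>\<phi>\<close> is filled by a term, so substitution only
  composes the \<open>t i\<close> and leaves the formula untouched.\<close>

definition defn :: "('r::rel_sym, 'a) fo_struct \<Rightarrow> 'a set \<Rightarrow> ((nat \<Rightarrow> 'a) \<Rightarrow> bool) \<Rightarrow> bool" where
  "defn S P R \<longleftrightarrow> (\<exists>\<phi> t. wf_fm \<phi> \<and> (\<forall>i. trm P (t i)) \<and>
     (\<forall>e. range e \<subseteq> univ S \<longrightarrow> (R e \<longleftrightarrow> sat S (\<lambda>i. t i e) \<phi>)))"

lemma defnE:
  assumes "defn S P R"
  obtains \<phi> t where "wf_fm \<phi>" "\<And>i. trm P (t i)"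
    "\<And>e. range e \<subseteq> univ S \<Longrightarrow> R e \<longleftrightarrow> sat S (\<lambda>i. t i e) \<phi>"
  using assms unfolding defn_def by blast

lemma defn_sat:
  assumes "wf_fm \<phi>" "\<And>i. trm P (t i)"
  shows "defn S P (\<lambda>e. sat S (\<lambda>i. t i e) \<phi>)"
  unfolding defn_def using assms by blast

lemma defn_cong:
  "defn S P R \<Longrightarrow> (\<And>e. range e \<subseteq> univ S \<Longrightarrow> R e = R' e) \<Longrightarrow> defn S P R'"
  unfolding defn_def by metis

lemma defn_mono:
  assumes "defn S P R" "P \<subseteq> P'"
  shows "defn S P' R"
proof -
  have "trm P' t" if "trm P t" for t using that assms(2) unfolding trm_def by blast
  then show ?thesis using assms(1) unfolding defn_def by meson
qed

lemma wf_ren [simp]: "wf_fm (ren f \<phi>) \<longleftrightarrow> wf_fm \<phi>"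
  by (induction \<phi> arbitrary: f) auto

lemma fv_ren: "fv (ren f \<phi>) \<subseteq> range f"
proof (induction \<phi> arbitrary: f)
  case (All \<phi>)
  show ?case
  proof
    fix i assume "i \<in> fv (ren f (fm.All \<phi>))"
    then have "Suc i \<in> range (case_nat 0 (\<lambda>i. Suc (f i)))" using All by auto
    then obtain k where "Suc i = case_nat 0 (\<lambda>i. Suc (f i)) k" by blast
    then show "i \<in> range f" by (cases k) auto
  qed
qed auto

lemma finite_fv: "finite (fv \<phi>)"
proof (induction \<phi>)
  case (All \<phi>)
  have "{i. Suc i \<in> fv \<phi>} = Suc -` fv \<phi>" by auto
  then show ?case using finite_vimageI[OF All, of Suc] by simp
qed auto

lemma sat_fv: "(\<And>i. i \<in> fv \<phi> \<Longrightarrow> e i = e' i) \<Longrightarrow> sat M e \<phi> \<longleftrightarrow> sat M e' \<phi>"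
proof (induction \<phi> arbitrary: e e')
  case (Rel r ks)
  then have "map e ks = map e' ks" by simp
  then show ?case by (simp only: sat.simps)
next
  case (Neg \<phi>)
  have "sat M e \<phi> \<longleftrightarrow> sat M e' \<phi>" by (rule Neg.IH) (use Neg.prems in simp)
  then show ?case by simp
next
  case (And \<phi> \<psi>)
  then show ?case by (metis UnI1 UnI2 fv.simps(4) sat.simps(4))
next
  case (All \<phi>)
  have "sat M (case_nat a e) \<phi> \<longleftrightarrow> sat M (case_nat a e') \<phi>" for a
    by (rule All.IH) (use All.prems in \<open>auto split: nat.split\<close>)
  then show ?case by simp
qed simp

lemma range_case_nat: "x \<in> A \<Longrightarrow> range e \<subseteq> A \<Longrightarrow> range (case_nat x e) \<subseteq> A"
  by (auto simp: image_subset_iff split: nat.split)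

lemma definability_defn:
  fixes S :: "('r::rel_sym, 'a) fo_struct"
  assumes E: "arity E = 2" and P: "P \<subseteq> univ S"
  shows "definability (univ S) (memrel S E) P (defn S P)"
proof
  show "x \<in> univ S \<and> y \<in> univ S" if "memrel S E x y" for x y
    using that by (simp add: memrel_def)
  show "P \<subseteq> univ S" by fact
  show "defn S P R \<Longrightarrow> (\<And>e. range e \<subseteq> univ S \<Longrightarrow> R e = R' e) \<Longrightarrow> defn S P R'" for R R'
    by (rule defn_cong)
  show "defn S P (\<lambda>e. R (\<lambda>i. t i e))" if "defn S P R" and t: "\<And>i. trm P (t i)" for R t
  proof -
    obtain \<phi> s where \<phi>: "wf_fm \<phi>" "\<And>i. trm P (s i)"
      "\<And>e. range e \<subseteq> univ S \<Longrightarrow> R e \<longleftrightarrow> sat S (\<lambda>i. s i e) \<phi>"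
      using \<open>defn S P R\<close> by (rule defnE) blast
    have "defn S P (\<lambda>e. sat S (\<lambda>i. s i (\<lambda>j. t j e)) \<phi>)"
      by (rule defn_sat[OF \<phi>(1)]) (rule trm_subst[OF \<phi>(2) t])
    then show ?thesis
    proof (rule defn_cong)
      fix e :: "nat \<Rightarrow> 'a" assume "range e \<subseteq> univ S"
      then have "range (\<lambda>i. t i e) \<subseteq> univ S" using trm_in[OF t P] by blast
      then show "sat S (\<lambda>i. s i (\<lambda>j. t j e)) \<phi> \<longleftrightarrow> R (\<lambda>i. t i e)" by (simp add: \<phi>(3))
    qed
  qed
  show "defn S P (\<lambda>e. e 0 = e 1)"
    using defn_sat[of "Eq 0 1" P "\<lambda>i e. e i" S] by (simp add: trm_var)
  have "defn S P (\<lambda>e. rel S E [e 0, e 1])"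
    using defn_sat[of "Rel E [0, 1]" P "\<lambda>i e. e i" S] E by (simp add: trm_var)
  then show "defn S P (\<lambda>e. memrel S E (e 0) (e 1))"
    by (rule defn_cong) (auto simp: memrel_def)
  show "defn S P (\<lambda>e. \<not> R e)" if R: "defn S P R" for R
  proof -
    obtain \<phi> s where \<phi>: "wf_fm \<phi>" "\<And>i. trm P (s i)"
      "\<And>e. range e \<subseteq> univ S \<Longrightarrow> R e \<longleftrightarrow> sat S (\<lambda>i. s i e) \<phi>"
      using R by (rule defnE) blast
    have "defn S P (\<lambda>e. sat S (\<lambda>i. s i e) (Neg \<phi>))"
      by (rule defn_sat) (use \<phi> in auto)
    then show ?thesis by (rule defn_cong) (use \<phi>(3) in auto)
  qed
  show "defn S P (\<lambda>e. R e \<and> R' e)" if R: "defn S P R" "defn S P R'" for R R'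
  proof -
    obtain \<phi> s where \<phi>: "wf_fm \<phi>" "\<And>i. trm P (s i)"
      "\<And>e. range e \<subseteq> univ S \<Longrightarrow> R e \<longleftrightarrow> sat S (\<lambda>i. s i e) \<phi>"
      using R(1) by (rule defnE) blast
    obtain \<psi> t where \<psi>: "wf_fm \<psi>" "\<And>i. trm P (t i)"
      "\<And>e. range e \<subseteq> univ S \<Longrightarrow> R' e \<longleftrightarrow> sat S (\<lambda>i. t i e) \<psi>"
      using R(2) by (rule defnE) blast
    \<comment> \<open>Even and odd variables keep the two formulas and their terms apart.\<close>
    have "defn S P (\<lambda>e. sat S (\<lambda>i. (if even i then s (i div 2) else t (i div 2)) e)
        (And (ren (\<lambda>i. 2 * i) \<phi>) (ren (\<lambda>i. 2 * i + 1) \<psi>)))"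
      by (rule defn_sat) (use \<phi> \<psi> in auto)
    then show ?thesis by (rule defn_cong) (use \<phi>(3) \<psi>(3) in \<open>auto simp: sat_ren comp_def\<close>)
  qed
  show "defn S P (\<lambda>e. \<forall>x \<in> univ S. Q x e)" if Q: "defn S P (\<lambda>e. Q (e 0) (\<lambda>i. e (Suc i)))" for Q
  proof -
    obtain \<phi> t where \<phi>: "wf_fm \<phi>" "\<And>i. trm P (t i)"
      "\<And>e. range e \<subseteq> univ S \<Longrightarrow> Q (e 0) (\<lambda>i. e (Suc i)) \<longleftrightarrow> sat S (\<lambda>i. t i e) \<phi>"
      using Q by (rule defnE) blast
    \<comment> \<open>Variables filled by the bound position, marked by \<open>v\<close>, all become
      the quantified variable 0. The others move up by one and are read with the bound position
      removed; in \<open>case_nat (e 0) e\<close> that position holds a dummy value.\<close>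
    define v where "v i \<longleftrightarrow> t i = (\<lambda>e. e 0)" for i
    define t' where "t' i = (if v i then (\<lambda>e. e 0) else (\<lambda>e. t i (case_nat (e 0) e)))" for i
    have cases: "v i \<or> (\<exists>k. t i = (\<lambda>e. e (Suc k))) \<or> (\<exists>a \<in> P. t i = (\<lambda>e. a))" for i
      using \<phi>(2)[of i] not0_implies_Suc unfolding trm_def v_def by metis
    have t': "trm P (t' i)" for i
      using cases[of i] unfolding t'_def by (auto intro: trm_var trm_const)
    have eq: "case_nat x (\<lambda>i. t' i e) \<circ> (\<lambda>i. if v i then 0 else Suc i) = (\<lambda>i. t i (case_nat x e))" for x e
    proof
      fix i
      show "(case_nat x (\<lambda>i. t' i e) \<circ> (\<lambda>i. if v i then 0 else Suc i)) i = t i (case_nat x e)"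
      proof (cases "v i")
        case True
        then show ?thesis by (simp add: v_def)
      next
        case False
        then show ?thesis using cases[of i] by (auto simp: t'_def)
      qed
    qed
    have "defn S P (\<lambda>e. sat S (\<lambda>i. t' i e) (fm.All (ren (\<lambda>i. if v i then 0 else Suc i) \<phi>)))"
      by (rule defn_sat) (use \<phi> t' in auto)
    then show ?thesis
    proof (rule defn_cong)
      fix e :: "nat \<Rightarrow> 'a" assume e: "range e \<subseteq> univ S"
      have "Q x e \<longleftrightarrow> sat S (\<lambda>i. t i (case_nat x e)) \<phi>" if "x \<in> univ S" for x
      proof -
        have "range (case_nat x e) \<subseteq> univ S" by (rule range_case_nat[OF that e])
        from \<phi>(3)[OF this] show ?thesis by simp
      qed
      then show "sat S (\<lambda>i. t' i e) (fm.All (ren (\<lambda>i. if v i then 0 else Suc i) \<phi>)) \<longleftrightarrow> (\<forall>x \<in> univ S. Q x e)"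
        by (simp add: sat_ren eq)
    qed
  qed
qed

text \<open>The shape of the axiom schemes: argument \<open>x\<close> at variable 1, value
  \<open>y\<close> at variable 0, parameters behind them.\<close>

lemma defn_binary:
  fixes S :: "('r::rel_sym, 'a) fo_struct"
  assumes "defn S (univ S) (\<lambda>e. R (e 0) (e 1))" and ne: "univ S \<noteq> {}"
  obtains \<phi> p where "wf_fm \<phi>" "range p \<subseteq> univ S"
    "\<And>x y. x \<in> univ S \<Longrightarrow> y \<in> univ S \<Longrightarrow> R x y \<longleftrightarrow> sat S (case_nat y (case_nat x p)) \<phi>"
proof -
  obtain \<phi> t where \<phi>: "wf_fm \<phi>" "\<And>i. trm (univ S) (t i)"
    "\<And>e. range e \<subseteq> univ S \<Longrightarrow> R (e 0) (e 1) \<longleftrightarrow> sat S (\<lambda>i. t i e) \<phi>"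
    using assms(1) by (rule defnE) blast
  obtain c where c: "c \<in> univ S" using ne by blast
  \<comment> \<open>The relation depends on positions 0 and 1 only, so all positions from 1 on may
    be read as \<open>y\<close>; constants move to places from 2 on. At places filled by a variable
    the parameter sequence holds the default \<open>c\<close>.\<close>
  define f where "f i = (if t i = (\<lambda>e. e 0) then 1 else if \<exists>k. t i = (\<lambda>e. e (Suc k)) then 0 else i + 2)" for i
  have eq: "case_nat y (case_nat x (\<lambda>i. t i (\<lambda>_. c))) \<circ> f = (\<lambda>i. t i (case_nat x (\<lambda>_. y)))" for x y
  proof
    fix i
    consider "t i = (\<lambda>e. e 0)" | "t i \<noteq> (\<lambda>e. e 0)" "\<exists>k. t i = (\<lambda>e. e (Suc k))"
      | "t i \<noteq> (\<lambda>e. e 0)" "\<not> (\<exists>k. t i = (\<lambda>e. e (Suc k)))" "\<exists>a. t i = (\<lambda>e. a)"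
      using \<phi>(2)[of i] not0_implies_Suc unfolding trm_def by metis
    then show "(case_nat y (case_nat x (\<lambda>i. t i (\<lambda>_. c))) \<circ> f) i = t i (case_nat x (\<lambda>_. y))"
      by cases (auto simp: f_def)
  qed
  show thesis
  proof
    show "wf_fm (ren f \<phi>)" using \<phi> by simp
    show "range (\<lambda>i. t i (\<lambda>_. c)) \<subseteq> univ S" using trm_in[OF \<phi>(2)] c by fastforce
    fix x y assume xy: "x \<in> univ S" "y \<in> univ S"
    have "range (case_nat x (\<lambda>_::nat. y)) \<subseteq> univ S" by (rule range_case_nat) (use xy in auto)
    from \<phi>(3)[OF this] show "R x y \<longleftrightarrow> sat S (case_nat y (case_nat x (\<lambda>i. t i (\<lambda>_. c)))) (ren f \<phi>)"
      by (simp add: sat_ren eq)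
  qed
qed

lemma zf_world_defn:
  fixes S :: "('r::rel_sym, 'a) fo_struct"
  assumes S: "S \<Turnstile> T" and T: "ZF_axioms E \<subseteq> T" and E: "arity E = 2"
  shows "zf_world (univ S) (memrel S E) (defn S (univ S))"
proof -
  interpret definability "univ S" "memrel S E" "univ S" "defn S (univ S)"
    by (rule definability_defn[OF E]) simp
  have ne: "univ S \<noteq> {}" using S by (simp add: models_def)
  then obtain c where c: "c \<in> univ S" by blast
  have ax: "sat S e \<phi>" if "\<phi> \<in> ZF_axioms E" "range e \<subseteq> univ S" for \<phi> e
    using S T that unfolding models_def by blast
  have ax': "sat S (\<lambda>_. c) \<phi>"
    if "\<phi> \<in> {ax_ext E, ax_found E, ax_pair E, ax_union E, ax_power E, ax_inf E}" for \<phi>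
    by (rule ax) (use that c in \<open>auto simp: ZF_axioms_def\<close>)
  note simple = ax'[of "ax_ext E"] ax'[of "ax_found E"] ax'[of "ax_pair E"]
    ax'[of "ax_union E"] ax'[of "ax_power E"]
  note simple = simple[unfolded sat_ZF_axioms, simplified]
  show ?thesis
  proof
    show "x = y" if "x \<in> univ S" "y \<in> univ S" "\<And>z. memrel S E z x \<longleftrightarrow> memrel S E z y" for x y
      using that simple(1) unfolding memrel_def by blast
    show "\<exists>y. memrel S E y x \<and> (\<forall>z. memrel S E z x \<longrightarrow> \<not> memrel S E z y)" if "memrel S E y x" for x y
      using that simple(2) unfolding memrel_def by blast
    show "\<exists>z. memrel S E x z \<and> memrel S E y z" if "x \<in> univ S" "y \<in> univ S" for x y
      using that simple(3) unfolding memrel_def by blast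
    show "\<exists>u \<in> univ S. \<forall>y z. memrel S E z y \<longrightarrow> memrel S E y x \<longrightarrow> memrel S E z u" if "x \<in> univ S" for x
      using that simple(4) unfolding memrel_def by blast
    show "\<exists>p \<in> univ S. \<forall>y \<in> univ S. (\<forall>z. memrel S E z y \<longrightarrow> memrel S E z x) \<longrightarrow> memrel S E y p"
      if x: "x \<in> univ S" for x
    proof -
      obtain p where p: "p \<in> univ S" "\<And>y. y \<in> univ S \<Longrightarrow>
          (\<And>z. z \<in> univ S \<Longrightarrow> rel S E [z, y] \<Longrightarrow> rel S E [z, x]) \<Longrightarrow> rel S E [y, p]"
        using bspec[OF simple(5) x] by blast
      show ?thesis
      proof (intro bexI[OF _ p(1)] ballI impI)
        fix y assume y: "y \<in> univ S" "\<forall>z. memrel S E z y \<longrightarrow> memrel S E z x"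
        have "rel S E [y, p]" by (rule p(2)[OF y(1)]) (use x y in \<open>auto simp: memrel_def\<close>)
        then show "memrel S E y p" using y p by (simp add: memrel_def)
      qed
    qed
    show "\<exists>x. (\<exists>y. memrel S E y x \<and> (\<forall>z. \<not> memrel S E z y)) \<and>
          (\<forall>y. memrel S E y x \<longrightarrow>
            (\<exists>w. memrel S E w x \<and> (\<forall>z. memrel S E z w \<longleftrightarrow> memrel S E z y \<or> z = y)))"
    proof -
      have "sat S (\<lambda>_. c) (ax_inf E)" by (rule ax') simp
      then obtain x where x: "x \<in> univ S"
        and x': "(\<exists>y \<in> univ S. rel S E [y, x] \<and> (\<forall>z \<in> univ S. \<not> rel S E [z, y])) \<and>
          (\<forall>y \<in> univ S. rel S E [y, x] \<longrightarrow>
             (\<exists>w \<in> univ S. rel S E [w, x] \<and> (\<forall>z \<in> univ S. rel S E [z, w] \<longleftrightarrow> rel S E [z, y] \<or> z = y)))"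
        unfolding sat_ZF_axioms by (rule bexE)
      obtain y where y: "y \<in> univ S" "rel S E [y, x] \<and> (\<forall>z \<in> univ S. \<not> rel S E [z, y])"
        using conjunct1[OF x'] by (rule bexE)
      have "\<exists>w. memrel S E w x \<and> (\<forall>z. memrel S E z w \<longleftrightarrow> memrel S E z y \<or> z = y)"
        if y: "memrel S E y x" for y
      proof -
        have y': "y \<in> univ S" "rel S E [y, x]" using y by (auto simp: memrel_def)
        obtain w where "w \<in> univ S"
          "rel S E [w, x] \<and> (\<forall>z \<in> univ S. rel S E [z, w] \<longleftrightarrow> rel S E [z, y] \<or> z = y)"
          using mp[OF bspec[OF conjunct2[OF x'] y'(1)] y'(2)] by (rule bexE)
        then have "memrel S E w x \<and> (\<forall>z. memrel S E z w \<longleftrightarrow> memrel S E z y \<or> z = y)"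
          using x y' by (auto simp: memrel_def)
        then show ?thesis by blast
      qed
      moreover have "memrel S E y x \<and> (\<forall>z. \<not> memrel S E z y)"
        using x y unfolding memrel_def by blast
      ultimately show ?thesis by blast
    qed
    show "\<exists>b \<in> univ S. \<forall>x. memrel S E x b \<longleftrightarrow> memrel S E x a \<and> Q x"
      if D: "defn S (univ S) (\<lambda>e. Q (e 0))" and a: "a \<in> univ S" for Q a
    proof -
      \<comment> \<open>Separation goes through \<open>defn_binary\<close> with a dummy argument,
        later filled by \<open>c\<close>.\<close>
      have "defn S (univ S) (\<lambda>e. Q (e 1))" by (rule D_subst1[OF D]) (rule trm_var)
      from defn_binary[of S "\<lambda>x y. Q y", OF this ne] obtain \<phi> p where \<phi>: "wf_fm \<phi>" "range p \<subseteq> univ S"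
        "\<And>x y. x \<in> univ S \<Longrightarrow> y \<in> univ S \<Longrightarrow> Q y \<longleftrightarrow> sat S (case_nat y (case_nat x p)) \<phi>" by metis
      have "sat S (case_nat c p) (ax_sep E \<phi>)"
        by (rule ax[OF _ range_case_nat[OF c \<phi>(2)]]) (use \<phi>(1) in \<open>auto simp: ZF_axioms_def\<close>)
      from bspec[OF this[unfolded sat_ZF_axioms] a] obtain b where b: "b \<in> univ S"
        "\<forall>x \<in> univ S. rel S E [x, b] \<longleftrightarrow> rel S E [x, a] \<and> sat S (case_nat x (case_nat c p)) \<phi>"
        by (rule bexE)
      have "memrel S E x b \<longleftrightarrow> memrel S E x a \<and> Q x" for x
        using b \<phi>(3)[OF c, of x] a by (auto simp: memrel_def)
      then show ?thesis using b(1) by blast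
    qed
    show "\<exists>b \<in> univ S. \<forall>x. memrel S E x a \<longrightarrow> (\<exists>y. memrel S E y b \<and> R x y)"
      if D: "defn S (univ S) (\<lambda>e. R (e 0) (e 1))" and a: "a \<in> univ S"
        and ex: "\<And>x. memrel S E x a \<Longrightarrow> \<exists>y \<in> univ S. R x y" for R a
    proof -
      from defn_binary[OF D ne] obtain \<phi> p where \<phi>: "wf_fm \<phi>" "range p \<subseteq> univ S"
        "\<And>x y. x \<in> univ S \<Longrightarrow> y \<in> univ S \<Longrightarrow> R x y \<longleftrightarrow> sat S (case_nat y (case_nat x p)) \<phi>" by metis
      have coll: "sat S p (ax_coll E \<phi>)"
        by (rule ax[OF _ \<phi>(2)]) (use \<phi>(1) in \<open>auto simp: ZF_axioms_def\<close>)
      have "\<exists>y \<in> univ S. sat S (case_nat y (case_nat x p)) \<phi>"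
        if "x \<in> univ S" "rel S E [x, a]" for x
        using ex[of x] that a \<phi>(3)[of x] by (auto simp: memrel_def)
      then have "\<forall>x \<in> univ S. rel S E [x, a] \<longrightarrow> (\<exists>y \<in> univ S. sat S (case_nat y (case_nat x p)) \<phi>)"
        by blast
      from mp[OF bspec[OF coll[unfolded sat_ZF_axioms] a] this] obtain b where b: "b \<in> univ S"
        "\<forall>x \<in> univ S. rel S E [x, a] \<longrightarrow>
          (\<exists>y \<in> univ S. rel S E [y, b] \<and> sat S (case_nat y (case_nat x p)) \<phi>)"
        by (rule bexE)
      show ?thesis
      proof (intro bexI[OF _ b(1)] allI impI)
        fix x assume "memrel S E x a"
        then have x: "x \<in> univ S" "rel S E [x, a]" by (auto simp: memrel_def)
        then obtain y where "y \<in> univ S" "rel S E [y, b]" "R x y"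
          using mp[OF bspec[OF b(2) x(1)] x(2)] \<phi>(3)[OF x(1)] by blast
        then show "\<exists>y. memrel S E y b \<and> R x y" using b(1) by (auto simp: memrel_def)
      qed
    qed
  qed
qed

section \<open>Isomorphisms and interpreted structures\<close>

lemma sat_iso:
  assumes "is_iso f M N" "wf_fm \<phi>" "range e \<subseteq> univ M"
  shows "sat M e \<phi> \<longleftrightarrow> sat N (f \<circ> e) \<phi>"
  using assms(2,3)
proof (induction \<phi> arbitrary: e)
  case (Eq i j)
  have "e i \<in> univ M" "e j \<in> univ M" using Eq by auto
  then show ?case using assms(1) by (auto simp: is_iso_def bij_betw_def inj_on_def)
next
  case (Rel r ks)
  then have "rel M r (map e ks) \<longleftrightarrow> rel N r (map f (map e ks))"
    using assms(1) by (auto simp: is_iso_def image_subset_iff)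
  then show ?case by (simp only: sat.simps map_map)
next
  case (All \<phi>)
  have surj: "univ N = f ` univ M" using assms(1) by (auto simp: is_iso_def bij_betw_def)
  have "sat M (case_nat a e) \<phi> \<longleftrightarrow> sat N (case_nat (f a) (f \<circ> e)) \<phi>" if "a \<in> univ M" for a
  proof -
    have "f \<circ> case_nat a e = case_nat (f a) (f \<circ> e)" by (rule ext) (simp split: nat.split)
    moreover have "wf_fm \<phi>" using All.prems by simp
    ultimately show ?thesis using All.IH[OF _ range_case_nat[OF that All.prems(2)]] by metis
  qed
  then show ?case unfolding sat.simps surj by blast
qed auto

lemma models_iso:
  assumes iso: "is_iso f M N" and M: "M \<Turnstile> T" and wf: "\<And>\<phi>. \<phi> \<in> T \<Longrightarrow> wf_fm \<phi>"
  shows "N \<Turnstile> T"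
  unfolding models_def
proof (intro conjI ballI allI impI)
  have bij: "univ N = f ` univ M" using iso by (auto simp: is_iso_def bij_betw_def)
  then show "univ N \<noteq> {}" using M by (auto simp: models_def)
  fix \<phi> and e :: "nat \<Rightarrow> _" assume \<phi>: "\<phi> \<in> T" and e: "range e \<subseteq> univ N"
  then have "\<forall>i. \<exists>a \<in> univ M. e i = f a" unfolding bij by blast
  then obtain d where d: "\<And>i. d i \<in> univ M" "\<And>i. e i = f (d i)" by metis
  have "sat M d \<phi>" using M \<phi> d unfolding models_def by blast
  then have "sat N (f \<circ> d) \<phi>" using sat_iso[OF iso wf[OF \<phi>]] d by blast
  moreover have "f \<circ> d = e" by (rule ext) (simp add: d(2))
  ultimately show "sat N e \<phi>" by simp
qed

lemma wf_connectives [simp]: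
  "wf_fm (Or \<phi> \<psi>) \<longleftrightarrow> wf_fm \<phi> \<and> wf_fm \<psi>" "wf_fm (Imp \<phi> \<psi>) \<longleftrightarrow> wf_fm \<phi> \<and> wf_fm \<psi>"
  "wf_fm (Iff \<phi> \<psi>) \<longleftrightarrow> wf_fm \<phi> \<and> wf_fm \<psi>" "wf_fm (Defs.Ex \<phi>) \<longleftrightarrow> wf_fm \<phi>"
  by (auto simp: Or_def Imp_def Iff_def Ex_def)

lemma wf_ZF_axioms: "arity E = 2 \<Longrightarrow> \<phi> \<in> ZF_axioms E \<Longrightarrow> wf_fm \<phi>"
  by (auto simp: ZF_axioms_def ax_ext_def ax_found_def ax_pair_def ax_union_def ax_power_def
      ax_inf_def ax_sep_def ax_coll_def)

lemma wf_foldr_Imp: "wf_fm (foldr Imp \<phi>s \<psi>) \<longleftrightarrow> (\<forall>\<phi> \<in> set \<phi>s. wf_fm \<phi>) \<and> wf_fm \<psi>"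
  by (induction \<phi>s) auto

lemma wf_map_MemI: "wf_fm (\<phi> :: set_sym fm) \<Longrightarrow> wf_fm (map_fm (\<lambda>_. MemI) \<phi>)"
  by (induction \<phi>) (auto simp: arity_set_sym_def arity_seti_sym_def)

lemma wf_ZFI:
  assumes "\<phi> \<in> ZFI"
  shows "wf_fm \<phi>"
proof -
  consider "\<phi> \<in> ZF_axioms MemI" | "\<phi> = ax_cofinal"
    | n \<psi> where "\<phi> = ax_indisc n \<psi>" "wf_fm \<psi>" using assms by (auto simp: ZFI_def)
  then show ?thesis
  proof cases
    case 1
    then show ?thesis by (rule wf_ZF_axioms[rotated]) (simp add: arity_seti_sym_def)
  next
    case 2
    then show ?thesis by (simp add: ax_cofinal_def fm_ord_def fm_trans_def arity_seti_sym_def)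
  next
    case 3
    then show ?thesis by (auto simp: ax_indisc_def wf_foldr_Imp wf_map_MemI arity_seti_sym_def)
  qed
qed

lemma defn_env:
  fixes M :: "('r::rel_sym, 'a) fo_struct"
  assumes "wf_fm \<phi>" "range q \<subseteq> univ M" "\<And>i. trm (univ M) (t i)"
  shows "defn M (univ M) (\<lambda>e. sat M (env (map (\<lambda>i. t i e) ks) q) \<phi>)"
proof -
  define s where "s i = (if i < length ks then t (ks ! i) else (\<lambda>e. q (i - length ks)))" for i
  have "env (map (\<lambda>i. t i e) ks) q = (\<lambda>i. s i e)" for e
    by (rule ext) (simp add: env_def s_def)
  moreover have "trm (univ M) (s i)" for i
    using assms(2,3) by (auto simp: s_def intro!: trm_const)
  ultimately show ?thesis using defn_sat[OF assms(1), of "univ M" s M] by simp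
qed

context
  fixes M :: "('r::rel_sym, 'a) fo_struct" and J :: "('s::rel_sym, 'r) interpretation_fms" and q
  assumes J: "par_interpretation M J q"
begin

lemma defn_univ_interpreted:
  assumes "trm (univ M) t"
  shows "defn M (univ M) (\<lambda>e. t e \<in> univ (interpreted M J q))"
proof -
  have "defn M (univ M) (\<lambda>e. sat M (env (map (\<lambda>i. t e) [0]) q) (dom_fm J))"
    by (rule defn_env) (use J assms in \<open>auto simp: par_interpretation_def\<close>)
  then show ?thesis
    by (rule defn_cong) (use trm_in[OF assms, of "univ M"] in \<open>auto simp: interpreted_def\<close>)
qed

text \<open>Induction on the formula: atoms unfold to the interpreting formulas, and quantifiers are
  relativised to the definable universe.\<close>

lemma defn_sat_interpreted:
  assumes E: "arity (E :: 'r) = 2" and t: "\<And>i. trm (univ M) (t i)"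
  shows "defn M (univ M) (\<lambda>e. sat (interpreted M J q) (\<lambda>i. t i e) \<phi>)"
  using t
proof (induction \<phi> arbitrary: t)
  interpret definability "univ M" "memrel M E" "univ M" "defn M (univ M)"
    by (rule definability_defn[OF E]) simp
  {
    case (Eq i j)
    then show ?case by (auto intro!: dfn)
  next
    case (Rel r ks)
    have "defn M (univ M) (\<lambda>e. sat M (env (map (\<lambda>i. t i e) ks) q) (rel_fm J r))"
      by (rule defn_env) (use J Rel in \<open>auto simp: par_interpretation_def\<close>)
    then show ?case by (simp add: interpreted_def)
  next
    case (Neg \<phi>)
    then show ?case by (auto intro!: dfn)
  next
    case (And \<phi> \<psi>)
    then show ?case by (auto intro!: dfn)
  next
    case (All \<phi>)
    define s where "s = case_nat (\<lambda>e :: nat \<Rightarrow> 'a. e 0) (\<lambda>i e. t i (\<lambda>i. e (Suc i)))"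
    have s: "trm (univ M) (s i)" for i
      using All.prems by (auto simp: s_def intro!: trm_var trm_shift split: nat.split)
    have eq: "case_nat (e 0) (\<lambda>i. t i (\<lambda>i. e (Suc i))) = (\<lambda>i. s i e)" for e
      by (rule ext) (simp add: s_def split: nat.split)
    have "defn M (univ M) (\<lambda>e. \<forall>x \<in> univ M. x \<in> univ (interpreted M J q) \<longrightarrow>
        sat (interpreted M J q) (case_nat x (\<lambda>i. t i e)) \<phi>)"
      by (intro dfn defn_univ_interpreted) (simp add: eq All.IH s)
    then show ?case by (rule defn_cong) (auto simp: interpreted_def)
  }
qed

lemma defn_interpreted2:
  assumes E: "arity (E :: 'r) = 2" and ne: "univ (interpreted M J q) \<noteq> {}"
    and R: "defn (interpreted M J q) (univ (interpreted M J q))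
      (\<lambda>e. R (e 0) (e 1))"
  shows "defn M (univ M) (\<lambda>e. e 0 \<in> univ (interpreted M J q) \<and> e 1 \<in> univ (interpreted M J q) \<and>
    R (e 0) (e 1))"
proof -
  interpret definability "univ M" "memrel M E" "univ M" "defn M (univ M)"
    by (rule definability_defn[OF E]) simp
  obtain \<phi> p where \<phi>: "wf_fm \<phi>" "range p \<subseteq> univ (interpreted M J q)"
    "\<And>x y. x \<in> univ (interpreted M J q) \<Longrightarrow> y \<in> univ (interpreted M J q) \<Longrightarrow>
      R x y \<longleftrightarrow> sat (interpreted M J q) (case_nat y (case_nat x p)) \<phi>"
    using defn_binary[OF R ne] by metis
  \<comment> \<open>The order of \<open>defn_binary\<close>: value at variable 0, argument at
    variable 1; inner parameters become constants from \<open>M\<close>.\<close>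
  define t where "t = case_nat (\<lambda>e :: nat \<Rightarrow> 'a. e 1) (case_nat (\<lambda>e. e 0) (\<lambda>i e. p i))"
  have t: "trm (univ M) (t i)" for i
    using \<phi>(2) by (auto simp: t_def interpreted_def intro!: trm_var trm_const split: nat.split)
  have eq: "case_nat (e (Suc 0)) (case_nat (e 0) p) = (\<lambda>i. t i e)" for e
    by (rule ext) (simp add: t_def split: nat.split)
  have "defn M (univ M) (\<lambda>e. e 0 \<in> univ (interpreted M J q) \<and> e 1 \<in> univ (interpreted M J q) \<and>
    sat (interpreted M J q) (\<lambda>i. t i e) \<phi>)"
    by (intro dfn defn_univ_interpreted defn_sat_interpreted[OF E] t)
  then show ?thesis by (rule defn_cong) (auto simp: \<phi>(3) eq)
qed

end

subsection \<open>Reduction to a single parameter\<close>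

text \<open>A formula has finitely many free variables, so only finitely many constants
  matter.\<close>

lemma defn_finite:
  assumes "defn S P R"
  obtains C where "finite C" "C \<subseteq> P" "defn S C R"
proof -
  obtain \<phi> t where \<phi>: "wf_fm \<phi>" "\<And>i. trm P (t i)"
    "\<And>e. range e \<subseteq> univ S \<Longrightarrow> R e \<longleftrightarrow> sat S (\<lambda>i. t i e) \<phi>"
    using assms by (rule defnE) blast
  define c where "c i = (SOME a. a \<in> P \<and> t i = (\<lambda>e. a))" for i
  define V where "V = {i \<in> fv \<phi>. \<exists>a \<in> P. t i = (\<lambda>e. a)}"
  have c: "c i \<in> P" "t i = (\<lambda>e. c i)" if "i \<in> V" for i
  proof -
    have "\<exists>a. a \<in> P \<and> t i = (\<lambda>e. a)" using that unfolding V_def by blast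
    from someI_ex[OF this] show "c i \<in> P" "t i = (\<lambda>e. c i)" unfolding c_def by blast+
  qed
  \<comment> \<open>Places outside \<open>fv \<phi>\<close> receive a variable, which costs no
    parameter.\<close>
  define t' where "t' i = (if i \<in> fv \<phi> then t i else (\<lambda>e. e 0))" for i
  have t': "trm (c ` V) (t' i)" for i
  proof (cases "i \<in> V")
    case True
    then have "t' i = (\<lambda>e. c i)" using c(2)[OF True] unfolding t'_def V_def by simp
    then show ?thesis using True by (simp add: trm_const)
  next
    case False
    then have "\<exists>k. t' i = (\<lambda>e. e k)" using \<phi>(2)[of i] unfolding t'_def trm_def V_def by auto
    then show ?thesis using trm_var by metis
  qed
  have "defn S (c ` V) (\<lambda>e. sat S (\<lambda>i. t' i e) \<phi>)"
    by (rule defn_sat) (use \<phi> t' in auto)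
  then have "defn S (c ` V) R"
  proof (rule defn_cong)
    fix e :: "nat \<Rightarrow> _" assume "range e \<subseteq> univ S"
    from \<phi>(3)[OF this] show "sat S (\<lambda>i. t' i e) \<phi> \<longleftrightarrow> R e"
      using sat_fv[of \<phi> "\<lambda>i. t' i e" "\<lambda>i. t i e" S] by (simp add: t'_def)
  qed
  moreover have "finite (c ` V)" using finite_fv[of \<phi>] by (simp add: V_def)
  ultimately show thesis using that c by blast
qed

text \<open>The constant \<open>c\<close> is replaced by a quantified variable tied to
  \<open>c\<close> by its definition.\<close>

lemma defn_eliminate_param:
  fixes S :: "('r::rel_sym, 'a) fo_struct"
  assumes E: "arity (E :: 'r) = 2" and P: "P \<subseteq> univ S" and c: "c \<in> univ S" "defn S P (\<lambda>e. e 0 = c)"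
    and R: "defn S (insert c P) R"
  shows "defn S P R"
proof -
  interpret definability "univ S" "memrel S E" P "defn S P"
    by (rule definability_defn[OF E P])
  obtain \<phi> t where \<phi>: "wf_fm \<phi>" "\<And>i. trm (insert c P) (t i)"
    "\<And>e. range e \<subseteq> univ S \<Longrightarrow> R e \<longleftrightarrow> sat S (\<lambda>i. t i e) \<phi>"
    using R by (rule defnE) blast
  define s where "s i = (if t i = (\<lambda>e. c) then (\<lambda>e. e 0) else (\<lambda>e. t i (\<lambda>i. e (Suc i))))" for i
  have s: "trm P (s i)" for i
    using \<phi>(2)[of i] unfolding s_def trm_def by auto
  have eq: "(\<lambda>i. s i (case_nat c e)) = (\<lambda>i. t i e)" for e
    by (rule ext) (simp add: s_def)
  have "defn S P (\<lambda>e. \<exists>x \<in> univ S. x = c \<and> sat S (\<lambda>i. s i (case_nat x e)) \<phi>)"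
  proof (intro D_ex D_conj c(2))
    have "(\<lambda>i. s i (case_nat (e 0) (\<lambda>i. e (Suc i)))) = (\<lambda>i. s i e)" for e
    proof -
      have "case_nat (e 0) (\<lambda>i. e (Suc i)) = e" by (rule ext) (simp split: nat.split)
      then show ?thesis by simp
    qed
    then show "defn S P (\<lambda>e. sat S (\<lambda>i. s i (case_nat (e 0) (\<lambda>i. e (Suc i)))) \<phi>)"
      using defn_sat[OF \<phi>(1) s] by simp
  qed
  then show ?thesis by (rule defn_cong) (use c \<phi>(3) in \<open>auto simp: eq\<close>)
qed

text \<open>Iterated pairing: both components of a pair are definable from it, so \<open>z\<close>
  defines the new \<open>c\<close> and the old code \<open>a\<close>, and through \<open>a\<close>
  the earlier parameters.\<close>

lemma defn_code_params:
  fixes S :: "('r::rel_sym, 'a) fo_struct"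
  assumes E: "arity E = 2" and Z: "zf_world (univ S) (memrel S E) D"
    and C: "finite C" "C \<subseteq> univ S"
  shows "\<exists>a \<in> univ S. \<forall>c \<in> C. defn S {a} (\<lambda>e. e 0 = c)"
  using C
proof (induction C)
  case empty
  interpret zf_world "univ S" "memrel S E" D by (rule Z)
  show ?case using empty_set by blast
next
  case (insert c C)
  interpret zf_world "univ S" "memrel S E" D by (rule Z)
  obtain a where a: "a \<in> univ S" "\<And>c. c \<in> C \<Longrightarrow> defn S {a} (\<lambda>e. e 0 = c)" using insert by blast
  have c: "c \<in> univ S" using insert by blast
  obtain z where z: "z \<in> univ S" "is_pair z a c" using pair_ex a c by blast
  interpret Z: definability "univ S" "memrel S E" "{z}" "defn S {z}"
    by (rule definability_defn[OF E]) (use z in simp)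
  have "defn S {z} (\<lambda>e. \<exists>u \<in> univ S. is_pair z u (e 0))" by (intro dfn) simp
  then have "defn S {z} (\<lambda>e. e 0 = c)"
    by (rule defn_cong) (use z a c is_pair_inject in blast)
  moreover have "defn S {z} (\<lambda>e. \<exists>u \<in> univ S. is_pair z (e 0) u)" by (intro dfn) simp
  then have za: "defn S {z} (\<lambda>e. e 0 = a)"
    by (rule defn_cong) (use z a c is_pair_inject in blast)
  have "defn S {z} (\<lambda>e. e 0 = d)" if "d \<in> C" for d
    by (rule defn_eliminate_param[OF E _ a(1) za]) (use z defn_mono[OF a(2)[OF that]] in auto)
  ultimately show ?case using z by blast
qed

lemma defn_single_param:
  fixes S :: "('r::rel_sym, 'a) fo_struct"
  assumes E: "arity E = 2" and Z: "zf_world (univ S) (memrel S E) D"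
    and Q: "defn S (univ S) (\<lambda>e. Q (e 0))"
  obtains a Q' where "a \<in> univ S" "defn S {} (\<lambda>e. Q' (e 0) (e 1))"
    "\<And>x. x \<in> univ S \<Longrightarrow> Q x \<longleftrightarrow> Q' x a"
proof -
  obtain C where C: "finite C" "C \<subseteq> univ S" "defn S C (\<lambda>e. Q (e 0))" using Q by (rule defn_finite)
  obtain a where a: "a \<in> univ S" "\<And>c. c \<in> C \<Longrightarrow> defn S {a} (\<lambda>e. e 0 = c)"
    using defn_code_params[OF E Z C(1,2)] by blast
  have Ca: "defn S (C \<union> {a}) (\<lambda>e. Q (e 0))" using C(3) by (rule defn_mono) blast
  \<comment> \<open>The parameters in \<open>C\<close> are eliminated one by one in favour of
    \<open>a\<close>.\<close>
  have "defn S {a} (\<lambda>e. Q (e 0))"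
    using C(1) Ca C(2) a(2)
  proof (induction C)
    case (insert c C)
    have "defn S (C \<union> {a}) (\<lambda>e. Q (e 0))"
    proof (rule defn_eliminate_param[OF E])
      show "defn S (insert c (C \<union> {a})) (\<lambda>e. Q (e 0))"
        using insert.prems(1) by (simp add: insert_commute)
      show "defn S (C \<union> {a}) (\<lambda>e. e 0 = c)"
        by (rule defn_mono[OF insert.prems(3)]) auto
    qed (use insert a in auto)
    then show ?case using insert by simp
  qed simp
  then obtain \<phi> t where \<phi>: "wf_fm \<phi>" "\<And>i. trm {a} (t i)"
    "\<And>e. range e \<subseteq> univ S \<Longrightarrow> Q (e 0) \<longleftrightarrow> sat S (\<lambda>i. t i e) \<phi>"
    by (rule defnE) blast
  \<comment> \<open>The parameter \<open>a\<close> becomes variable 1 and every other place variable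
    0, since \<open>Q x\<close> may be evaluated in the environment that is constantly
    \<open>x\<close>.\<close>
  define s where "s i = (if t i = (\<lambda>e. a) then (\<lambda>e. e 1) else (\<lambda>e :: nat \<Rightarrow> 'a. e 0))" for i
  define Q' where "Q' x y \<longleftrightarrow> sat S (\<lambda>i. s i (case_nat x (\<lambda>_. y))) \<phi>" for x y
  have "defn S {} (\<lambda>e. sat S (\<lambda>i. s i e) \<phi>)"
    by (rule defn_sat) (use \<phi> in \<open>auto simp: s_def intro: trm_var\<close>)
  moreover have "Q' (e 0) (e 1) \<longleftrightarrow> sat S (\<lambda>i. s i e) \<phi>" for e
  proof -
    have "(\<lambda>i. s i (case_nat (e 0) (\<lambda>_. e 1))) = (\<lambda>i. s i e)" by (rule ext) (simp add: s_def)
    then show ?thesis by (simp add: Q'_def)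
  qed
  ultimately have "defn S {} (\<lambda>e. Q' (e 0) (e 1))" by simp
  moreover have "Q x \<longleftrightarrow> Q' x a" if "x \<in> univ S" for x
  proof -
    have "(\<lambda>i. s i (case_nat x (\<lambda>_. a))) = (\<lambda>i. t i (\<lambda>_. x))"
    proof
      fix i
      show "s i (case_nat x (\<lambda>_. a)) = t i (\<lambda>_. x)"
        using \<phi>(2)[of i] by (auto simp: s_def trm_def)
    qed
    then show ?thesis using \<phi>(3)[of "\<lambda>_. x"] that by (simp add: Q'_def image_subset_iff)
  qed
  ultimately show thesis using that a(1) by blast
qed

section \<open>Indiscernibles are not definable\<close>

definition reduct :: "(seti_sym, 'a) fo_struct \<Rightarrow> (set_sym, 'a) fo_struct" where
  "reduct N = \<lparr>univ = univ N, rel = (\<lambda>_. rel N MemI)\<rparr>"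

lemma univ_reduct [simp]: "univ (reduct N) = univ N"
  by (simp add: reduct_def)

lemma sat_reduct: "sat N e (map_fm (\<lambda>_. MemI) \<phi>) \<longleftrightarrow> sat (reduct N) e \<phi>"
  by (induction \<phi> arbitrary: e) (simp_all add: reduct_def)

lemma memrel_reduct: "memrel (reduct N) Mem = memrel N MemI"
  by (intro ext) (simp add: memrel_def reduct_def)

lemma defn_reduct:
  assumes "defn (reduct N) P R"
  shows "defn N P R"
proof -
  obtain \<phi> t where \<phi>: "wf_fm \<phi>" "\<And>i. trm P (t i)"
    "\<And>e. range e \<subseteq> univ (reduct N) \<Longrightarrow> R e \<longleftrightarrow> sat (reduct N) (\<lambda>i. t i e) \<phi>"
    using assms by (rule defnE) blast
  have "defn N P (\<lambda>e. sat N (\<lambda>i. t i e) (map_fm (\<lambda>_. MemI) \<phi>))"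
    by (rule defn_sat[OF wf_map_MemI[OF \<phi>(1)] \<phi>(2)])
  then show ?thesis by (rule defn_cong) (simp add: sat_reduct \<phi>(3))
qed

lemma defn_ternary_formula:
  fixes S :: "('r::rel_sym, 'a) fo_struct"
  assumes "defn S {} (\<lambda>e. B (e 0) (e 1) (e 2))"
  obtains \<theta> where "wf_fm \<theta>" "fv \<theta> \<subseteq> {..<3}"
    "\<And>e. range e \<subseteq> univ S \<Longrightarrow> sat S e \<theta> \<longleftrightarrow> B (e 0) (e 1) (e 2)"
proof -
  obtain \<phi> t where \<phi>: "wf_fm \<phi>" "\<And>i. trm {} (t i)"
    "\<And>e. range e \<subseteq> univ S \<Longrightarrow> B (e 0) (e 1) (e 2) \<longleftrightarrow> sat S (\<lambda>i. t i e) \<phi>"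
    using assms by (rule defnE) blast
  from \<phi>(2) have "\<forall>i. \<exists>k. t i = (\<lambda>e. e k)" unfolding trm_def by blast
  then obtain k where k: "\<And>i. t i = (\<lambda>e. e (k i))" by metis
  \<comment> \<open>Positions beyond 2 are redirected to 0, as \<open>B\<close> depends on the first
    three only; \<open>d\<close> below is the matching environment.\<close>
  define f where "f i = (if k i < 3 then k i else 0)" for i
  show thesis
  proof
    show "wf_fm (ren f \<phi>)" using \<phi> by simp
    show "fv (ren f \<phi>) \<subseteq> {..<3}" using fv_ren[of f \<phi>] by (auto simp: f_def split: if_splits)
    fix e :: "nat \<Rightarrow> 'a" assume e: "range e \<subseteq> univ S"
    define d where "d i = (if i < 3 then e i else e 0)" for i
    have "range d \<subseteq> univ S" using e by (auto simp: d_def)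
    moreover have "(\<lambda>i. t i d) = e \<circ> f" by (rule ext) (simp add: k d_def f_def)
    ultimately show "sat S e (ren f \<phi>) \<longleftrightarrow> B (e 0) (e 1) (e 2)"
      using \<phi>(3)[of d] by (simp add: sat_ren d_def)
  qed
qed

lemma (in zf_world) mem_minimal:
  assumes D: "D (\<lambda>e. Q (e 0))" and x: "x \<in> U" "Q x"
  shows "\<exists>m \<in> U. Q m \<and> (\<forall>y. y \<sqin> m \<longrightarrow> \<not> Q y)"
  using mem_induct[OF D_not[OF D]] x by blast

text \<open>Indiscernibility concerns parameter-free formulas, while the definition of
  \<open>Q\<close> may use a parameter \<open>a\<close>. Quantifying over all \<open>z\<close> of
  rank at most that of an indiscernible \<open>\<alpha>\<close> covers \<open>a\<close> without
  naming it.\<close>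

lemma indiscernibles_not_definable:
  assumes N: "N \<Turnstile> ZFI" and Q: "defn (reduct N) (univ N) (\<lambda>e. Q (e 0))"
    and Q_Ind: "\<And>x. x \<in> univ N \<Longrightarrow> rel N Ind [x] \<longleftrightarrow> Q x"
  shows False
proof -
  let ?U = "univ N" and ?E = "memrel N MemI"
  interpret N: zf_world ?U ?E "defn N ?U"
    by (rule zf_world_defn[OF N]) (auto simp: ZFI_def arity_seti_sym_def)
  interpret K: definability ?U ?E "{}" "defn (reduct N) {}"
    using definability_defn[of Mem "{}" "reduct N"]
    by (simp add: memrel_reduct arity_set_sym_def)
  have Z: "zf_world (univ (reduct N)) (memrel (reduct N) Mem) (defn N ?U)"
    unfolding memrel_reduct univ_reduct by (rule N.zf_world_axioms)
  have ar: "arity Mem = 2" and Q: "defn (reduct N) (univ (reduct N)) (\<lambda>e. Q (e 0))"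
    using Q by (simp_all add: arity_set_sym_def)
  obtain a Q' where a: "a \<in> univ (reduct N)" and Q': "defn (reduct N) {} (\<lambda>e. Q' (e 0) (e 1))"
    and QQ': "\<And>x. x \<in> univ (reduct N) \<Longrightarrow> Q x \<longleftrightarrow> Q' x a"
    by (rule defn_single_param[OF ar Z Q]) (rule that)
  note a = a[unfolded univ_reduct]
  have Ind: "rel N Ind [x] \<longleftrightarrow> Q' x a" if "x \<in> ?U" for x
    using Q_Ind QQ' that by simp
  have Q'N: "defn N ?U (\<lambda>e. Q' (e 0) (e 1))"
    by (rule defn_mono[OF defn_reduct[OF Q']]) simp
  have D_Ind: "defn N ?U (\<lambda>e. Q' (e 0) a)"
    by (rule N.D_subst2[OF Q'N]) (intro dfn a)+
  have Ax: "sat N e \<phi>" if "\<phi> \<in> ZFI" "range e \<subseteq> ?U" for e \<phi>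
    using N that unfolding models_def by blast
  have "sat N (\<lambda>_. a) ax_cofinal" by (rule Ax) (use a in \<open>auto simp: ZFI_def\<close>)
  note cofinal = this[unfolded sat_ax_cofinal]
  have Ind_ord: "N.ordinal x" if "x \<in> ?U" "Q' x a" for x
    using cofinal that Ind unfolding N.ordinal_def memrel_def by blast
  have Ind_cofinal: "\<exists>y. Q' y a \<and> ?E x y" if x: "x \<in> ?U" "N.ordinal x" for x
  proof -
    have "\<exists>y \<in> ?U. rel N Ind [y] \<and> rel N MemI [x, y]"
    proof (rule mp[OF bspec[OF conjunct2[OF cofinal] x(1)]], intro conjI ballI impI)
      fix y z assume "y \<in> ?U" "rel N MemI [y, x]" "z \<in> ?U" "rel N MemI [z, y]"
      then show "rel N MemI [z, x]" using N.ordinal_trans[of z y x] x by (simp add: memrel_def)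
    next
      fix w y z assume "w \<in> ?U" "rel N MemI [w, x]" "y \<in> ?U" "rel N MemI [y, w]"
        "z \<in> ?U" "rel N MemI [z, y]"
      then show "rel N MemI [z, w]"
        using N.ordinal_trans[of z y w] N.ordinal_mem[of w x] x by (simp add: memrel_def)
    qed
    then show ?thesis using x Ind unfolding memrel_def by blast
  qed
  define T where "T \<alpha> x z \<longleftrightarrow> (\<exists>w. ?E w x \<and> ?E \<alpha> w \<and> Q' w z)" for \<alpha> x z
  define B where "B \<alpha> x y \<longleftrightarrow> (\<forall>z \<in> ?U. N.rank_le z \<alpha> \<longrightarrow> (T \<alpha> x z \<longleftrightarrow> T \<alpha> y z))" for \<alpha> x y
  have "defn (reduct N) {} (\<lambda>e. B (e 0) (e 1) (e 2))"
    unfolding B_def T_def by (intro dfn K.D_subst2[OF Q'])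
  then obtain \<theta> where \<theta>: "wf_fm \<theta>" "fv \<theta> \<subseteq> {..<3}"
    "\<And>e. range e \<subseteq> ?U \<Longrightarrow> sat (reduct N) e \<theta> \<longleftrightarrow> B (e 0) (e 1) (e 2)"
    by (rule defn_ternary_formula) auto
  have indisc: "B \<alpha> x y \<longleftrightarrow> B \<alpha>' x' y'"
    if "Q' \<alpha> a" "Q' x a" "Q' y a" "Q' \<alpha>' a" "Q' x' a" "Q' y' a"
      and lt: "?E \<alpha> x" "?E x y" "?E \<alpha>' x'" "?E x' y'" for \<alpha> x y \<alpha>' x' y'
  proof -
    \<comment> \<open>The two triples occupy variables 0 to 2 and 3 to 5, as
      \<open>ax_indisc 3\<close> requires; \<open>y'\<close> fills the rest.\<close>
    define e where "e = case_nat \<alpha> (case_nat x (case_nat y (case_nat \<alpha>' (case_nat x' (\<lambda>_. y')))))"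
    have e [simp]: "e 0 = \<alpha>" "e 1 = x" "e (Suc 0) = x" "e 2 = y" "e 3 = \<alpha>'" "e 4 = x'" "e 5 = y'"
      by (simp_all add: e_def numeral_eq_Suc)
    have U: "\<alpha> \<in> ?U" "x \<in> ?U" "y \<in> ?U" "\<alpha>' \<in> ?U" "x' \<in> ?U" "y' \<in> ?U"
      using lt by (auto simp: memrel_def)
    have range_e: "range e \<subseteq> ?U" unfolding e_def by (intro range_case_nat U) (use U in auto)
    have "ax_indisc 3 \<theta> \<in> ZFI" using \<theta> by (auto simp: ZFI_def)
    from Ax[OF this range_e] have "(\<forall>i < 6. rel N Ind [e i]) \<longrightarrow>
      (\<forall>i < 2. rel N MemI [e i, e (i + 1)]) \<longrightarrow> (\<forall>i < 2. rel N MemI [e (3 + i), e (3 + i + 1)]) \<longrightarrow>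
      (sat (reduct N) e \<theta> \<longleftrightarrow> sat (reduct N) (\<lambda>i. e (3 + i)) \<theta>)"
      unfolding sat_ax_indisc sat_reduct by simp
    moreover have "rel N Ind [e i]" for i
      using that(1-6) Ind U unfolding e_def by (auto split: nat.split)
    moreover have "rel N MemI [e i, e (i + 1)]" if "i < 2" for i
      using that lt less_2_cases[OF that] by (auto simp: memrel_def numeral_2_eq_2[symmetric])
    moreover have "rel N MemI [e (3 + i), e (3 + i + 1)]" if "i < 2" for i
      using that lt less_2_cases[OF that] by (auto simp: memrel_def)
    ultimately have "sat (reduct N) e \<theta> \<longleftrightarrow> sat (reduct N) (\<lambda>i. e (3 + i)) \<theta>" by blast
    moreover have "range (\<lambda>i. e (3 + i)) \<subseteq> ?U" using range_e by blast
    ultimately show ?thesis using \<theta>(3)[OF range_e] \<theta>(3)[of "\<lambda>i. e (3 + i)"] by simp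
  qed
  \<comment> \<open>\<open>\<alpha>\<close> is taken high enough that \<open>a\<close> occurs among
    the codes \<open>z\<close> compared by \<open>B\<close>.\<close>
  obtain \<gamma> where \<gamma>: "\<gamma> \<in> ?U" "N.ordinal \<gamma>" "N.rank_le a \<gamma>" using N.ordinal_above a by blast
  obtain \<alpha> where \<alpha>: "Q' \<alpha> a" "?E \<gamma> \<alpha>" using Ind_cofinal \<gamma> by blast
  have \<alpha>U: "\<alpha> \<in> ?U" using \<alpha> N.mem_U by blast
  have a_le: "N.rank_le a \<alpha>" using N.rank_le_trans \<gamma> N.mem_rank_le \<alpha> a \<alpha>U by blast
  have next_Ind: "\<exists>y. Q' y a \<and> ?E x y \<and> (\<forall>w. ?E w y \<longrightarrow> \<not> (Q' w a \<and> ?E x w))"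
    if x: "x \<in> ?U" "Q' x a" for x
  proof -
    obtain y where y: "Q' y a" "?E x y" using Ind_cofinal Ind_ord x by blast
    have "defn N ?U (\<lambda>e. Q' (e 0) a \<and> ?E x (e 0))" by (intro dfn D_Ind x)
    from N.mem_minimal[OF this, of y] y N.mem_U show ?thesis by blast
  qed
  \<comment> \<open>No indiscernible lies strictly between \<open>\<alpha>\<close> and
    \<open>x1\<close>, while \<open>x1\<close> itself lies between \<open>\<alpha>\<close> and
    \<open>x2\<close>; so the code \<open>a\<close> separates \<open>x1\<close> from
    \<open>x2\<close>.\<close>
  obtain x1 where x1: "Q' x1 a" "?E \<alpha> x1" "\<And>w. ?E w x1 \<Longrightarrow> \<not> (Q' w a \<and> ?E \<alpha> w)"
    using next_Ind \<alpha> \<alpha>U by blast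
  obtain x2 where x2: "Q' x2 a" "?E x1 x2" using next_Ind x1 N.mem_U by blast
  have "\<not> T \<alpha> x1 a" "T \<alpha> x2 a" using x1 x2 unfolding T_def by blast+
  then have not_B: "\<not> B \<alpha> x1 x2" using a a_le unfolding B_def by blast
  obtain S where S: "S \<in> ?U" "\<And>z. z \<in> ?U \<Longrightarrow> N.rank_le z \<alpha> \<Longrightarrow> ?E z S"
    using N.small_rank_le[OF \<alpha>U] unfolding N.small_def by blast
  \<comment> \<open>For \<open>z\<close> other than \<open>a\<close> the class coded by
    \<open>z\<close> may contain non-ordinals. Only its ordinals are bounded by
    \<open>ordinal_strict_bound\<close>, and only these can lie below an ordinal.\<close>
  define W where "W z w \<longleftrightarrow> N.ordinal w \<and> ?E \<alpha> w \<and> Q' w z" for z w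
  have D_W: "defn N ?U (\<lambda>e. W (e 0) (e 1))"
    unfolding W_def by (intro dfn N.D_subst2[OF Q'N] \<alpha>U)
  \<comment> \<open>The implication keeps the relation total: codes without a witness accept any
    value.\<close>
  have "defn N ?U (\<lambda>e. (\<exists>w \<in> ?U. W (e 0) w) \<longrightarrow> W (e 0) (e 1))"
    by (intro dfn N.D_subst2[OF D_W])
  from N.collection[OF this S(1)] obtain b where b: "b \<in> ?U"
    "\<And>z. ?E z S \<Longrightarrow> \<exists>v. ?E v b \<and> ((\<exists>w \<in> ?U. W z w) \<longrightarrow> W z v)" using a by blast
  \<comment> \<open>\<open>\<sigma>\<close> lies above some witness for every code in
    \<open>S\<close> that has one, so beyond \<open>\<sigma>\<close> the answers of \<open>T\<close>
    to these codes no longer change.\<close>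
  obtain \<sigma> where \<sigma>: "\<sigma> \<in> ?U" "N.ordinal \<sigma>" "\<And>v. ?E v b \<Longrightarrow> N.ordinal v \<Longrightarrow> ?E v \<sigma>"
    using N.ordinal_strict_bound[OF b(1)] by blast
  obtain \<tau> where \<tau>: "\<tau> \<in> ?U" "N.ordinal \<tau>" "?E \<sigma> \<tau>" "?E \<alpha> \<tau>"
  proof -
    obtain c where c: "c \<in> ?U" "N.is_upair c \<sigma> \<alpha>" using N.upair_ex \<sigma> \<alpha>U by blast
    have "?E \<sigma> c" "?E \<alpha> c" using N.is_upair_iff[OF c(2)] \<sigma> \<alpha>U by blast+
    then show thesis using N.ordinal_strict_bound[OF c(1)] \<sigma>(2) Ind_ord[OF \<alpha>U \<alpha>(1)] that by blast
  qed
  obtain x where x: "Q' x a" "?E \<tau> x" using Ind_cofinal \<tau> by blast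
  have xU: "x \<in> ?U" "N.ordinal x" using x N.mem_U Ind_ord by blast+
  obtain y where y: "Q' y a" "?E x y" using Ind_cofinal xU by blast
  have yU: "y \<in> ?U" "N.ordinal y" using y N.mem_U Ind_ord by blast+
  have \<sigma>x: "?E \<sigma> x" "?E \<alpha> x" using N.ordinal_trans \<tau> x xU by blast+
  have "B \<alpha> x y" unfolding B_def
  proof (intro ballI impI iffI)
    fix z assume "T \<alpha> x z"
    then show "T \<alpha> y z" unfolding T_def using N.ordinal_trans[OF _ y(2) yU(2)] by blast
  next
    fix z assume z: "z \<in> ?U" "N.rank_le z \<alpha>" and "T \<alpha> y z"
    then obtain w where w: "?E w y" "?E \<alpha> w" "Q' w z" unfolding T_def by blast
    then have "W z w" using N.ordinal_mem yU unfolding W_def by blast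
    then obtain v where v: "?E v b" "W z v" using b(2)[OF S(2)[OF z]] w N.mem_U by blast
    have "?E v x" using N.ordinal_trans[OF \<sigma>(3) \<sigma>x(1) xU(2)] v unfolding W_def by blast
    then show "T \<alpha> x z" using v unfolding T_def W_def by blast
  qed
  then have "B \<alpha> x1 x2" using indisc[OF \<alpha>(1) x(1) y(1) \<alpha>(1) x1(1) x2(1) \<sigma>x(2) y(2) x1(2) x2(2)] by blast
  then show False using not_B by blast
qed

section \<open>Definability across isomorphisms, and the contradiction\<close>

lemma defn_iso:
  fixes M :: "('r::rel_sym, 'a) fo_struct" and K :: "('r, 'b) fo_struct"
  assumes iso: "is_iso f M K" and Q: "defn M (univ M) (\<lambda>e. Q (e 0))"
    and Q': "\<And>x. x \<in> univ M \<Longrightarrow> Q' (f x) \<longleftrightarrow> Q x"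
  shows "defn K (univ K) (\<lambda>e. Q' (e 0))"
proof -
  obtain \<phi> t where \<phi>: "wf_fm \<phi>" "\<And>i. trm (univ M) (t i)"
    "\<And>e. range e \<subseteq> univ M \<Longrightarrow> Q (e 0) \<longleftrightarrow> sat M (\<lambda>i. t i e) \<phi>"
    using Q by (rule defnE) blast
  have surj: "univ K = f ` univ M" using iso by (auto simp: is_iso_def bij_betw_def)
  \<comment> \<open>Constants are moved by \<open>f\<close>, and a constant term may be evaluated at
    \<open>undefined\<close>. All variables become \<open>e 0\<close>, on which alone the predicate
    depends.\<close>
  define s where "s i = (if \<exists>k. t i = (\<lambda>e. e k) then (\<lambda>e :: nat \<Rightarrow> 'b. e 0) else (\<lambda>e. f (t i undefined)))" for i
  have "trm (univ K) (s i)" for i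
    using \<phi>(2)[of i] unfolding s_def surj by (auto simp: trm_def)
  then have "defn K (univ K) (\<lambda>e. sat K (\<lambda>i. s i e) \<phi>)" by (rule defn_sat[OF \<phi>(1)])
  then show ?thesis
  proof (rule defn_cong)
    fix e :: "nat \<Rightarrow> 'b" assume "range e \<subseteq> univ K"
    then obtain x where x: "x \<in> univ M" "e 0 = f x" unfolding surj by blast
    have "(\<lambda>i. s i e) = f \<circ> (\<lambda>i. t i (\<lambda>_. x))"
    proof
      fix i
      show "s i e = (f \<circ> (\<lambda>i. t i (\<lambda>_. x))) i"
      proof (cases "\<exists>k. t i = (\<lambda>e. e k)")
        case True
        then have "s i e = f x" "t i (\<lambda>_. x) = x" using x by (auto simp: s_def)
        then show ?thesis by simp
      next
        case False
        then show ?thesis using \<phi>(2)[of i] by (auto simp: s_def trm_def)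
      qed
    qed
    moreover have "range (\<lambda>i. t i (\<lambda>_. x)) \<subseteq> univ M" using trm_in[OF \<phi>(2)] x by fastforce
    ultimately have "sat K (\<lambda>i. s i e) \<phi> \<longleftrightarrow> sat M (\<lambda>i. t i (\<lambda>_. x)) \<phi>"
      using sat_iso[OF iso \<phi>(1)] by metis
    also have "\<dots> \<longleftrightarrow> Q x" using \<phi>(3)[of "\<lambda>_. x"] x by auto
    finally show "sat K (\<lambda>i. s i e) \<phi> \<longleftrightarrow> Q' (e 0)" using Q' x by simp
  qed
qed

lemma par_definable_mapE:
  assumes "par_definable_map M f"
  obtains \<phi> p where "wf_fm \<phi>" "range p \<subseteq> univ M"
    "\<And>x y. x \<in> univ M \<Longrightarrow> y \<in> univ M \<Longrightarrow> f x = y \<longleftrightarrow> sat M (env [x, y] p) \<phi>"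
proof -
  obtain \<phi> p where "wf_fm \<phi> \<and> range p \<subseteq> univ M \<and>
      (\<forall>x \<in> univ M. \<forall>y \<in> univ M. f x = y \<longleftrightarrow> sat M (env [x, y] p) \<phi>)"
    using assms unfolding par_definable_map_def by (elim exE)
  then show thesis by (intro that[of \<phi> p]) simp_all
qed

lemma comp_env: "f \<circ> env xs p = env (map f xs) (f \<circ> p)"
  by (rule ext) (simp add: env_def)

theorem theorem5p9:
  fixes M :: "(set_sym, 'a) fo_struct"
    and N :: "(seti_sym, 'b) fo_struct"
  assumes "M \<Turnstile> ZF" and "N \<Turnstile> ZFI"
  shows "\<not> par_bi_interpretable M N"
proof
  assume "par_bi_interpretable M N"
  then obtain I p J q i j F G where
    I: "par_interpretation N I p" and
    J: "par_interpretation M J q" and j: "is_iso j N (interpreted M J q)" and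
    F: "par_definable_map M F" "is_iso F M (interpreted (interpreted M J q) I (j \<circ> p))" and
    G: "par_definable_map N G" "is_iso G N (interpreted (interpreted N I p) J (i \<circ> q))"
    unfolding par_bi_interpretable_def by blast
  \<comment> \<open>The comparison takes place inside \<open>M\<close>: \<open>N'\<close> is the
    copy of \<open>N\<close> there, and \<open>Ms\<close> the copy of \<open>M\<close> inside
    \<open>N'\<close>.\<close>
  define N' where "N' = interpreted M J q"
  define Ms where "Ms = interpreted N' I (j \<circ> p)"
  have ar: "arity Mem = 2" "arity MemI = 2" "arity Ind = 1"
    by (simp_all add: arity_set_sym_def arity_seti_sym_def)
  have j': "is_iso j N N'" using j by (simp add: N'_def)
  have j_surj: "univ N' = j ` univ N"
    using j' by (auto simp: is_iso_def bij_betw_def)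
  have N': "N' \<Turnstile> ZFI" by (rule models_iso[OF j' assms(2) wf_ZFI])
  have ne: "univ N' \<noteq> {}" using N' by (simp add: models_def)
  have I': "par_interpretation N' I (j \<circ> p)"
    using I unfolding par_interpretation_def j_surj by auto
  obtain \<phi> r where \<phi>: "wf_fm \<phi>" "range r \<subseteq> univ M"
    "\<And>x y. x \<in> univ M \<Longrightarrow> y \<in> univ M \<Longrightarrow> F x = y \<longleftrightarrow> sat M (env [x, y] r) \<phi>"
    using F(1) by (rule par_definable_mapE) blast
  obtain \<psi> s where \<psi>: "wf_fm \<psi>" "range s \<subseteq> univ N"
    "\<And>x y. x \<in> univ N \<Longrightarrow> y \<in> univ N \<Longrightarrow> G x = y \<longleftrightarrow> sat N (env [x, y] s) \<psi>"
    using G(1) by (rule par_definable_mapE) blast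
  have s': "range (j \<circ> s) \<subseteq> univ N'" using \<psi>(2) j_surj by auto
  have sat_j: "sat N (env xs u) \<chi> \<longleftrightarrow> sat N' (env (map j xs) (j \<circ> u)) \<chi>"
    if "wf_fm \<chi>" "set xs \<subseteq> univ N" "range u \<subseteq> univ N" for xs u \<chi>
  proof -
    have "env xs u k \<in> univ N" for k
      using that(2,3) nth_mem[of k xs] by (auto simp: env_def)
    then have "range (env xs u) \<subseteq> univ N" by blast
    from sat_iso[OF j' that(1) this] show ?thesis by (simp only: comp_env)
  qed
  \<comment> \<open>The graph of \<open>G\<close> carried along \<open>j\<close>; the same formula
    with transported parameters defines it in \<open>N'\<close>.\<close>
  define Gr where "Gr x y \<longleftrightarrow> x \<in> univ N' \<and> y \<in> univ N' \<and> sat N' (env [x, y] (j \<circ> s)) \<psi>" for x y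
  have Gr_j: "Gr (j x) (j y) \<longleftrightarrow> G x = y" if "x \<in> univ N" "y \<in> univ N" for x y
    using sat_j[OF \<psi>(1) _ \<psi>(2), of "[x, y]"] \<psi>(3) that by (auto simp: Gr_def j_surj)
  have F_iso: "is_iso F M Ms" using F(2) by (simp add: Ms_def N'_def)
  interpret M: zf_world "univ M" "memrel M Mem" "defn M (univ M)"
    by (rule zf_world_defn[OF assms(1)]) (simp_all add: ZF_def ar)
  interpret N: zf_world "univ N'" "memrel N' MemI" "defn N' (univ N')"
    by (rule zf_world_defn[OF N']) (auto simp: ZFI_def ar)
  have D_U': "defn M (univ M) (\<lambda>e. e 0 \<in> univ N')"
    unfolding N'_def by (rule defn_univ_interpreted[OF J]) (rule trm_var)
  have transfer2: "defn M (univ M) (\<lambda>e. e 0 \<in> univ N' \<and> e 1 \<in> univ N' \<and> R (e 0) (e 1))"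
    if "defn N' (univ N') (\<lambda>e. R (e 0) (e 1))" for R
    using defn_interpreted2[OF J ar(1), of R] that ne unfolding N'_def by blast
  have transfer1: "defn M (univ M) (\<lambda>e. e 0 \<in> univ N' \<and> Q (e 0))"
    if "defn N' (univ N') (\<lambda>e. Q (e 0))" for Q
    \<comment> \<open>The binary transfer with variable 0 in both places.\<close>
    using M.D_subst2[OF transfer2[of "\<lambda>x y. Q x", OF that] trm_var trm_var, of 0 0] by simp
  interpret mutual_interpretation "univ M" "memrel M Mem" "defn M (univ M)"
    "univ N'" "memrel N' MemI" "defn N' (univ N')" "univ Ms" "memrel Ms Mem" F Gr
  proof
    show "univ N' \<subseteq> univ M" by (auto simp: N'_def interpreted_def)
    show "defn N' (univ N') (\<lambda>e. Q (e 0)) \<Longrightarrow> defn M (univ M) (\<lambda>e. e 0 \<in> univ N' \<and> Q (e 0))" for Q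
      by (rule transfer1)
    show "defn N' (univ N') (\<lambda>e. R (e 0) (e 1)) \<Longrightarrow>
        defn M (univ M) (\<lambda>e. e 0 \<in> univ N' \<and> e 1 \<in> univ N' \<and> R (e 0) (e 1))" for R
      by (rule transfer2)
    show "defn M (univ M) (\<lambda>e. e 0 \<in> univ N')" by (rule D_U')
    show "univ Ms \<subseteq> univ N'" by (auto simp: Ms_def interpreted_def)
    show D_Ms: "defn N' (univ N') (\<lambda>e. e 0 \<in> univ Ms)"
      unfolding Ms_def by (rule defn_univ_interpreted[OF I']) (rule trm_var)
    show "memrel Ms Mem x y \<Longrightarrow> x \<in> univ Ms \<and> y \<in> univ Ms" for x y by (simp add: memrel_def)
    have "defn N' (univ N') (\<lambda>e. sat N' (env (map (\<lambda>i. e i) [0, 1]) (j \<circ> p)) (rel_fm I Mem))"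
      by (rule defn_env) (use I' in \<open>auto simp: par_interpretation_def intro: trm_var\<close>)
    then have "defn N' (univ N') (\<lambda>e. e 0 \<in> univ Ms \<and> e 1 \<in> univ Ms \<and>
        sat N' (env (map (\<lambda>i. e i) [0, 1]) (j \<circ> p)) (rel_fm I Mem))"
      by (intro N.D_conj N.D_subst1[OF D_Ms] trm_var)
    then show "defn N' (univ N') (\<lambda>e. memrel Ms Mem (e 0) (e 1))"
      by (simp add: memrel_def Ms_def interpreted_def)
    show "bij_betw F (univ M) (univ Ms)" using F_iso by (simp add: is_iso_def)
    have "defn M (univ M) (\<lambda>e. sat M (env (map (\<lambda>i. e i) [0, 1]) r) \<phi>)"
      by (rule defn_env) (use \<phi> in \<open>auto intro: trm_var\<close>)
    then show "defn M (univ M) (\<lambda>e. F (e 0) = e 1)"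
      by (rule defn_cong) (use \<phi>(3) in \<open>auto simp: image_subset_iff\<close>)
    show "memrel Ms Mem (F x) (F y) \<longleftrightarrow> memrel M Mem x y" if "x \<in> univ M" "y \<in> univ M" for x y
    proof -
      have "rel M Mem [x, y] \<longleftrightarrow> rel Ms Mem (map F [x, y])"
        by (rule F_iso[unfolded is_iso_def, THEN conjunct2, rule_format]) (use that ar in auto)
      moreover have "F x \<in> univ Ms" "F y \<in> univ Ms"
        using F_iso that by (auto simp: is_iso_def bij_betw_def)
      ultimately show ?thesis using that by (simp add: memrel_def)
    qed
    have "defn N' (univ N') (\<lambda>e. sat N' (env (map (\<lambda>i. e i) [0, 1]) (j \<circ> s)) \<psi>)"
      by (rule defn_env[OF \<psi>(1) s']) (rule trm_var)
    then show "defn N' (univ N') (\<lambda>e. Gr (e 0) (e 1))"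
      by (rule defn_cong) (auto simp: Gr_def image_subset_iff)
    show "\<exists>y \<in> univ Ms. Gr x y" if x: "x \<in> univ N'" for x
    proof -
      obtain x' where x': "x' \<in> univ N" "x = j x'" using x unfolding j_surj by blast
      \<comment> \<open>\<open>G\<close> lands in a structure interpreted inside
        \<open>interpreted N I p\<close>, whose universe \<open>j\<close> carries into
        \<open>Ms\<close>.\<close>
      have "G x' \<in> univ (interpreted (interpreted N I p) J (i \<circ> q))"
        using G(2) x' by (auto simp: is_iso_def bij_betw_def)
      then have y: "G x' \<in> univ N" "sat N (env [G x'] p) (dom_fm I)"
        by (auto simp: interpreted_def)
      then have "j (G x') \<in> univ Ms"
        using sat_j[of "dom_fm I" "[G x']" p] I j_surj
        by (auto simp: Ms_def interpreted_def par_interpretation_def)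
      then show ?thesis using Gr_j x' y by blast
    qed
    show "x = x'" if x: "x \<in> univ N'" "x' \<in> univ N'" "Gr x y" "Gr x' y" for x x' y
    proof -
      have "y \<in> univ N'" using x by (simp add: Gr_def)
      then obtain u u' v where uv: "u \<in> univ N" "u' \<in> univ N" "v \<in> univ N" "x = j u" "x' = j u'" "y = j v"
        using x(1,2) unfolding j_surj by blast
      then have "G u = G u'" using Gr_j x(3,4) by metis
      then have "u = u'" using G(2) uv unfolding is_iso_def bij_betw_def by (auto dest: inj_onD)
      then show ?thesis using uv by simp
    qed
  qed
  have h_iso: "is_iso h M (reduct N')"
    unfolding is_iso_def
  proof (intro conjI allI impI)
    show "bij_betw h (univ M) (univ (reduct N'))" using definable_isomorphism(1) by simp
    fix R :: set_sym and xs assume xs: "set xs \<subseteq> univ M" "length xs = arity R"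
    then have "length xs = Suc (Suc 0)" by (simp add: arity_set_sym_def numeral_2_eq_2)
    then obtain x y where xy: "xs = [x, y]" by (auto simp: length_Suc_conv)
    moreover have "R = Mem" by (cases R) simp
    ultimately show "rel M R xs \<longleftrightarrow> rel (reduct N') R (map h xs)"
      using definable_isomorphism(3)[of x y] h_U' xs by (simp add: memrel_def reduct_def)
  qed
  \<comment> \<open>\<open>Ind\<close> of \<open>N'\<close> is definable in \<open>M\<close> by the
    interpretation. Pulled back along the definable map \<open>h\<close> and pushed forward along
    the isomorphism \<open>h\<close> onto the reduct, it becomes definable from membership and
    parameters.\<close>
  have "defn N' (univ N') (\<lambda>e. sat N' (\<lambda>i. e i) (Rel Ind [0]))"
    by (rule defn_sat) (simp_all add: ar trm_var)
  then have "defn N' (univ N') (\<lambda>e. rel N' Ind [e 0])" by simp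
  note Ind = transfer1[OF this]
  have "defn M (univ M) (\<lambda>e. \<exists>y \<in> univ M. h (e 0) = y \<and> (y \<in> univ N' \<and> rel N' Ind [y]))"
    by (rule M.D_ex, rule M.D_conj[OF M.D_subst2[OF D_h trm_var trm_var] M.D_subst1[OF Ind trm_var]])
  then have "defn M (univ M) (\<lambda>e. rel N' Ind [h (e 0)])"
    by (rule defn_cong) (use h_U' U'_sub in \<open>auto simp: image_subset_iff subset_iff\<close>)
  then have "defn (reduct N') (univ (reduct N')) (\<lambda>e. rel N' Ind [e 0])"
    by (rule defn_iso[OF h_iso, of _ "\<lambda>x. rel N' Ind [x]"]) simp
  then show False using indiscernibles_not_definable[OF N', of "\<lambda>x. rel N' Ind [x]"] by simp
qed

end
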